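(* Unless the Exponential Time Hypothesis fails, there is no algorithm that solves WSP restricted to instances in which all constraints are user-independent in time $O^*(2^{o(k\log k)})$, where $k$ is the number of tasks.
   Context: An instance of WSP is a tuple $(S,U,A,C)$: $S$ a finite set of tasks ($k=|S|$), $U$ a finite set of users ($n=|U|$), $A(s)\subseteq U$ the authorization list of $s\in S$ (arbitrary), $C$ a set of constraints ($m=|C|$); a constraint is a pair $(L,\Theta)$ with $L\subseteq S$ and $\Theta$ a set of functions $L\to U$. A plan $\pi:T\to X$ ($T\subseteq S$, $X\subseteq U$) satisfies $(L,\Theta)$ if $L\setminus T\neq\emptyset$ or $\pi|_L\in\Theta$; it is eligible if it satisfies all constraints, authorized if $\pi(s)\in A(s)$ for all $s\in T$, valid if both, complete if it is a plan $S\to U$. WSP asks whether a valid complete plan exists (and to output one if so). A constraint $(L,\Theta)$ is user-independent if $\psi\circ\theta\in\Theta$ for all $\theta\in\Theta$ and all permutations $\psi$ of $U$. $O^*(h)$ means $O(q(n,k,m)h)$ for a polynomial $q$. The Exponential Time Hypothesis (ETH) states that there is no algorithm solving 3-SAT on $N$ variables in time $O^*(2^{o(N)})$. *)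

theory Defs
  imports
    Complex_Main
    "HOL-Library.FuncSet"
    "HOL-Library.Landau_Symbols"
    "HOL-Combinatorics.Permutations"
begin

section \<open>Algorithms and running time\<close>

text \<open>
  Algorithms are the programs of the WHILE language over binary trees (N. D. Jones,
  \<^emph>\<open>Computability and Complexity from a Programming Perspective\<close>): trees are the only data,
  and every elementary operation costs one step. Since trees can be shared and there is no
  built-in comparison of trees, this cost measure is polynomially related to
  (deterministic) Turing machine time, and bounds of the form \<open>O*(2^o(g))\<close> are insensitive to
  polynomial changes of the machine model.
\<close>

datatype val = Nl | Pr val val

datatype expr = Var nat | NlE | PrE expr expr | Hd expr | Tl expr

datatype com = Skip | Assign nat expr | Seq com com | If expr com com | While expr com

type_synonym state = "nat \<Rightarrow> val"

fun hd_val :: "val \<Rightarrow> val" where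
  "hd_val Nl = Nl"
| "hd_val (Pr a b) = a"

fun tl_val :: "val \<Rightarrow> val" where
  "tl_val Nl = Nl"
| "tl_val (Pr a b) = b"

fun eval_expr :: "expr \<Rightarrow> state \<Rightarrow> val" where
  "eval_expr (Var x) s = s x"
| "eval_expr NlE s = Nl"
| "eval_expr (PrE e f) s = Pr (eval_expr e s) (eval_expr f s)"
| "eval_expr (Hd e) s = hd_val (eval_expr e s)"
| "eval_expr (Tl e) s = tl_val (eval_expr e s)"

fun cost :: "expr \<Rightarrow> nat" where
  "cost (Var x) = 1"
| "cost NlE = 1"
| "cost (PrE e f) = 1 + cost e + cost f"
| "cost (Hd e) = 1 + cost e"
| "cost (Tl e) = 1 + cost e"

text \<open>
  \<open>exec c s t s'\<close>: command \<open>c\<close> started in state \<open>s\<close> halts after exactly \<open>t\<close> steps in state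
  \<open>s'\<close>. As a truth value, \<^const>\<open>Nl\<close> is false and every other tree is true.
\<close>

inductive exec :: "com \<Rightarrow> state \<Rightarrow> nat \<Rightarrow> state \<Rightarrow> bool" where
  Skip: "exec Skip s 1 s"
| Assign: "exec (Assign x e) s (1 + cost e) (s(x := eval_expr e s))"
| Seq: "exec c\<^sub>1 s\<^sub>1 t\<^sub>1 s\<^sub>2 \<Longrightarrow> exec c\<^sub>2 s\<^sub>2 t\<^sub>2 s\<^sub>3 \<Longrightarrow> exec (Seq c\<^sub>1 c\<^sub>2) s\<^sub>1 (t\<^sub>1 + t\<^sub>2) s\<^sub>3"
| IfTrue: "eval_expr e s \<noteq> Nl \<Longrightarrow> exec c\<^sub>1 s t s' \<Longrightarrow> exec (If e c\<^sub>1 c\<^sub>2) s (1 + cost e + t) s'"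
| IfFalse: "eval_expr e s = Nl \<Longrightarrow> exec c\<^sub>2 s t s' \<Longrightarrow> exec (If e c\<^sub>1 c\<^sub>2) s (1 + cost e + t) s'"
| WhileFalse: "eval_expr e s = Nl \<Longrightarrow> exec (While e c) s (1 + cost e) s"
| WhileTrue: "eval_expr e s\<^sub>1 \<noteq> Nl \<Longrightarrow> exec c s\<^sub>1 t\<^sub>1 s\<^sub>2 \<Longrightarrow> exec (While e c) s\<^sub>2 t\<^sub>2 s\<^sub>3
    \<Longrightarrow> exec (While e c) s\<^sub>1 (1 + cost e + t\<^sub>1 + t\<^sub>2) s\<^sub>3"

lemma exec_deterministic:
  "exec c s t s' \<Longrightarrow> exec c s u s'' \<Longrightarrow> t = u \<and> s' = s''"
proof (induction arbitrary: u s'' rule: exec.induct)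
  case (Seq c\<^sub>1 s\<^sub>1 t\<^sub>1 s\<^sub>2 c\<^sub>2 t\<^sub>2 s\<^sub>3)
  from Seq.prems show ?case by cases (use Seq.IH in blast)
next
  case (WhileTrue e s\<^sub>1 c t\<^sub>1 s\<^sub>2 t\<^sub>2 s\<^sub>3)
  from WhileTrue.prems show ?case by cases (use WhileTrue in blast)+
qed (erule exec.cases; fastforce)+

text \<open>Input and output are passed in variable 0; all other variables are initially \<^const>\<open>Nl\<close>.\<close>

definition runs :: "com \<Rightarrow> val \<Rightarrow> nat \<Rightarrow> val \<Rightarrow> bool" where
  "runs P x t y \<longleftrightarrow> (\<exists>s. exec P ((\<lambda>_. Nl)(0 := x)) t s \<and> s 0 = y)"

text \<open>\<open>polynomial_in X q\<close>: \<open>q\<close> is a polynomial with real coefficients in the numerical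
  parameters \<open>X\<close> of the inputs.\<close>

inductive polynomial_in :: "('i \<Rightarrow> nat) set \<Rightarrow> ('i \<Rightarrow> real) \<Rightarrow> bool"
  for X :: "('i \<Rightarrow> nat) set" where
  const: "polynomial_in X (\<lambda>_. c)"
| param: "p \<in> X \<Longrightarrow> polynomial_in X (\<lambda>i. real (p i))"
| add: "polynomial_in X q \<Longrightarrow> polynomial_in X r \<Longrightarrow> polynomial_in X (\<lambda>i. q i + r i)"
| mult: "polynomial_in X q \<Longrightarrow> polynomial_in X r \<Longrightarrow> polynomial_in X (\<lambda>i. q i * r i)"

text \<open>
  A computational problem is given by the set \<open>D\<close> of its inputs, which are pairs of an instance
  and a tree encoding it, and a relation \<open>ans\<close> between instances and correct outputs.
  \<open>solvable_in_Ostar D ans X h\<close>: some program solves the problem in time \<open>O(q h)\<close> for a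
  polynomial \<open>q\<close> in the parameters \<open>X\<close>.
\<close>

definition solvable_in_Ostar ::
  "('i \<times> val) set \<Rightarrow> ('i \<Rightarrow> val \<Rightarrow> bool) \<Rightarrow> ('i \<times> val \<Rightarrow> nat) set \<Rightarrow> ('i \<times> val \<Rightarrow> real) \<Rightarrow> bool"
where
  "solvable_in_Ostar D ans X h \<longleftrightarrow>
     (\<exists>P q C. polynomial_in X q \<and>
       (\<forall>(I, x) \<in> D. \<exists>t y. runs P x t y \<and> ans I y \<and> real t \<le> C * (q (I, x) * h (I, x))))"

fun enc_list :: "('a \<Rightarrow> val) \<Rightarrow> 'a list \<Rightarrow> val" where
  "enc_list f [] = Nl"
| "enc_list f (a # as) = Pr (f a) (enc_list f as)"

text \<open>Numbers are encoded in unary; they only occur as names of (and as the number of) tasks,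
  users and propositional variables.\<close>

definition enc_nat :: "nat \<Rightarrow> val" where
  "enc_nat n = enc_list (\<lambda>_. Nl) [0..<n]"

definition enc_bool :: "bool \<Rightarrow> val" where
  "enc_bool b = (if b then Pr Nl Nl else Nl)"

section \<open>3-SAT and the Exponential Time Hypothesis\<close>

text \<open>\<open>(b, v)\<close> is the literal that is true iff variable \<open>v\<close> has value \<open>b\<close>. The literals of a
  clause need not be distinct, so clauses with fewer than three literals are covered.\<close>

type_synonym literal = "bool \<times> nat"
type_synonym clause = "literal \<times> literal \<times> literal"
type_synonym formula = "nat \<times> clause list"

fun sat_literal :: "(nat \<Rightarrow> bool) \<Rightarrow> literal \<Rightarrow> bool" where
  "sat_literal \<alpha> (b, v) \<longleftrightarrow> \<alpha> v = b"

fun sat_clause :: "(nat \<Rightarrow> bool) \<Rightarrow> clause \<Rightarrow> bool" where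
  "sat_clause \<alpha> (l\<^sub>1, l\<^sub>2, l\<^sub>3) \<longleftrightarrow> sat_literal \<alpha> l\<^sub>1 \<or> sat_literal \<alpha> l\<^sub>2 \<or> sat_literal \<alpha> l\<^sub>3"

definition satisfiable :: "formula \<Rightarrow> bool" where
  "satisfiable \<phi> \<longleftrightarrow> (\<exists>\<alpha>. \<forall>c \<in> set (snd \<phi>). sat_clause \<alpha> c)"

definition is_3cnf :: "formula \<Rightarrow> bool" where
  "is_3cnf \<phi> \<longleftrightarrow>
     (\<forall>(l\<^sub>1, l\<^sub>2, l\<^sub>3) \<in> set (snd \<phi>). snd l\<^sub>1 < fst \<phi> \<and> snd l\<^sub>2 < fst \<phi> \<and> snd l\<^sub>3 < fst \<phi>)"

fun enc_literal :: "literal \<Rightarrow> val" where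
  "enc_literal (b, v) = Pr (enc_bool b) (enc_nat v)"

fun enc_clause :: "clause \<Rightarrow> val" where
  "enc_clause (l\<^sub>1, l\<^sub>2, l\<^sub>3) = enc_list enc_literal [l\<^sub>1, l\<^sub>2, l\<^sub>3]"

definition enc_formula :: "formula \<Rightarrow> val" where
  "enc_formula \<phi> = Pr (enc_nat (fst \<phi>)) (enc_list enc_clause (snd \<phi>))"

definition sat3_inputs :: "(formula \<times> val) set" where
  "sat3_inputs = {(\<phi>, x). is_3cnf \<phi> \<and> x = enc_formula \<phi>}"

definition sat3_answer :: "formula \<Rightarrow> val \<Rightarrow> bool" where
  "sat3_answer \<phi> y \<longleftrightarrow> (y \<noteq> Nl \<longleftrightarrow> satisfiable \<phi>)"

definition num_vars :: "formula \<times> val \<Rightarrow> nat" where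
  "num_vars i = fst (fst i)"

definition num_clauses :: "formula \<times> val \<Rightarrow> nat" where
  "num_clauses i = length (snd (fst i))"

definition ETH :: bool where
  "ETH \<longleftrightarrow> \<not> (\<exists>f \<in> o(\<lambda>N::nat. real N).
     solvable_in_Ostar sat3_inputs sat3_answer {num_vars, num_clauses}
       (\<lambda>i. 2 powr f (num_vars i)))"

section \<open>The workflow satisfiability problem\<close>

text \<open>Functions \<open>L \<rightarrow> U\<close> are represented by the extensional functions
  \<^term>\<open>L \<rightarrow>\<^sub>E U\<close>.\<close>

type_synonym ('s, 'u) wsp_constraint = "'s set \<times> ('s \<Rightarrow> 'u) set"

record ('s, 'u) wsp =
  tasks :: "'s set"
  users :: "'u set"
  auth :: "'s \<Rightarrow> 'u set"
  constraints :: "('s, 'u) wsp_constraint set"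

definition wsp_instance :: "('s, 'u) wsp \<Rightarrow> bool" where
  "wsp_instance W \<longleftrightarrow> finite (tasks W) \<and> finite (users W) \<and>
     (\<forall>s \<in> tasks W. auth W s \<subseteq> users W) \<and>
     (\<forall>(L, \<Theta>) \<in> constraints W. L \<subseteq> tasks W \<and> \<Theta> \<subseteq> (L \<rightarrow>\<^sub>E users W))"

definition plan :: "('s, 'u) wsp \<Rightarrow> 's set \<Rightarrow> 'u set \<Rightarrow> ('s \<Rightarrow> 'u) \<Rightarrow> bool" where
  "plan W T X \<pi> \<longleftrightarrow> T \<subseteq> tasks W \<and> X \<subseteq> users W \<and> \<pi> \<in> T \<rightarrow>\<^sub>E X"

definition satisfies :: "'s set \<Rightarrow> ('s \<Rightarrow> 'u) \<Rightarrow> ('s, 'u) wsp_constraint \<Rightarrow> bool" where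
  "satisfies T \<pi> c \<longleftrightarrow> fst c - T \<noteq> {} \<or> restrict \<pi> (fst c) \<in> snd c"

definition eligible :: "('s, 'u) wsp \<Rightarrow> 's set \<Rightarrow> ('s \<Rightarrow> 'u) \<Rightarrow> bool" where
  "eligible W T \<pi> \<longleftrightarrow> (\<forall>c \<in> constraints W. satisfies T \<pi> c)"

definition authorized :: "('s, 'u) wsp \<Rightarrow> 's set \<Rightarrow> ('s \<Rightarrow> 'u) \<Rightarrow> bool" where
  "authorized W T \<pi> \<longleftrightarrow> (\<forall>s \<in> T. \<pi> s \<in> auth W s)"

definition valid :: "('s, 'u) wsp \<Rightarrow> 's set \<Rightarrow> ('s \<Rightarrow> 'u) \<Rightarrow> bool" where
  "valid W T \<pi> \<longleftrightarrow> eligible W T \<pi> \<and> authorized W T \<pi>"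

definition valid_complete_plan :: "('s, 'u) wsp \<Rightarrow> ('s \<Rightarrow> 'u) \<Rightarrow> bool" where
  "valid_complete_plan W \<pi> \<longleftrightarrow> plan W (tasks W) (users W) \<pi> \<and> valid W (tasks W) \<pi>"

definition user_independent :: "('s, 'u) wsp \<Rightarrow> ('s, 'u) wsp_constraint \<Rightarrow> bool" where
  "user_independent W c \<longleftrightarrow>
     (\<forall>\<theta> \<in> snd c. \<forall>\<psi>. \<psi> permutes users W \<longrightarrow> compose (fst c) \<psi> \<theta> \<in> snd c)"

text \<open>
  To be given to a program, the \<open>k\<close> tasks and \<open>n\<close> users are named \<open>0, \<dots>, k - 1\<close> and
  \<open>0, \<dots>, n - 1\<close>, and all sets are listed without repetitions, in any order. A constraint
  \<open>(L, \<Theta>)\<close> is presented by a list \<open>ls\<close> of its scope and the list of the value vectors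
  \<^term>\<open>map \<theta> ls\<close> of all \<open>\<theta> \<in> \<Theta>\<close>.
\<close>

definition lists_set :: "'a list \<Rightarrow> 'a set \<Rightarrow> bool" where
  "lists_set as A \<longleftrightarrow> distinct as \<and> set as = A"

fun encodes_constraint :: "(nat, nat) wsp_constraint \<Rightarrow> val \<Rightarrow> bool" where
  "encodes_constraint (L, \<Theta>) x \<longleftrightarrow>
     (\<exists>ls ts. lists_set ls L \<and> lists_set ts ((\<lambda>\<theta>. map \<theta> ls) ` \<Theta>) \<and>
        x = Pr (enc_list enc_nat ls) (enc_list (enc_list enc_nat) ts))"

definition encodes_wsp :: "(nat, nat) wsp \<Rightarrow> val \<Rightarrow> bool" where
  "encodes_wsp W x \<longleftrightarrow>
     (\<exists>k n as cs xs. tasks W = {..<k} \<and> users W = {..<n} \<and>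
        length as = k \<and> (\<forall>s<k. lists_set (as ! s) (auth W s)) \<and>
        lists_set cs (constraints W) \<and> list_all2 encodes_constraint cs xs \<and>
        x = enc_list (\<lambda>v. v)
              [enc_nat k, enc_nat n, enc_list (enc_list enc_nat) as, enc_list (\<lambda>v. v) xs])"

definition ui_wsp_inputs :: "((nat, nat) wsp \<times> val) set" where
  "ui_wsp_inputs =
     {(W, x). wsp_instance W \<and> (\<forall>c \<in> constraints W. user_independent W c) \<and> encodes_wsp W x}"

text \<open>The output \<^const>\<open>Nl\<close> means that there is no valid complete plan; otherwise such a plan
  has to be output, tagged so that the empty plan differs from \<^const>\<open>Nl\<close>.\<close>

definition wsp_answer :: "(nat, nat) wsp \<Rightarrow> val \<Rightarrow> bool" where
  "wsp_answer W y \<longleftrightarrow>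
     (if \<exists>\<pi>. valid_complete_plan W \<pi>
      then \<exists>\<pi>. valid_complete_plan W \<pi> \<and>
             y = Pr Nl (enc_list enc_nat (map \<pi> [0..<card (tasks W)]))
      else y = Nl)"

definition num_tasks :: "(nat, nat) wsp \<times> val \<Rightarrow> nat" where
  "num_tasks i = card (tasks (fst i))"

definition num_users :: "(nat, nat) wsp \<times> val \<Rightarrow> nat" where
  "num_users i = card (users (fst i))"

definition num_constraints :: "(nat, nat) wsp \<times> val \<Rightarrow> nat" where
  "num_constraints i = card (constraints (fst i))"

text \<open>The length of the input is not polynomially bounded in \<open>n\<close>, \<open>k\<close> and \<open>m\<close>, because a single
  constraint may contain up to \<open>n\<^sup>k\<close> functions. A lower bound that also allows a factor polynomial
  in the input length shows that hardness is not just due to the time needed to read the input.\<close>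

definition input_length :: "(nat, nat) wsp \<times> val \<Rightarrow> nat" where
  "input_length i = size (snd i)"

end

theory Submission
  imports Defs
begin

text \<open>
  A 3-SAT instance with \<open>N\<close> variables is reduced in polynomial time to WSP with \<open>k log k = O(N)\<close>.
  Split the variables into groups of \<open>b \<approx> log N / 2\<close>, and let the \<open>n = 2^b\<close> users stand for the
  assignments of a group; there is a task \<open>x\<^sub>j\<close> for each group. User-independent constraints only see which
  tasks are performed by the same user, so for each user \<open>u\<close> there is an anchor task \<open>a\<^sub>u\<close> that only
  \<open>u\<close> may perform. That groups \<open>j\<^sub>1, j\<^sub>2, j\<^sub>3\<close> do not receive three assignments \<open>i\<^sub>1, i\<^sub>2, i\<^sub>3\<close> which
  falsify a clause is now user-independent: not all of \<open>x\<^bsub>j\<^sub>1\<^esub> = a\<^bsub>i\<^sub>1\<^esub>\<close>, \<open>x\<^bsub>j\<^sub>2\<^esub> = a\<^bsub>i\<^sub>2\<^esub>\<close>,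
  \<open>x\<^bsub>j\<^sub>3\<^esub> = a\<^bsub>i\<^sub>3\<^esub>\<close>. Its scope has bounded size, so it can be listed with \<open>n^6\<close> value vectors. Each task
  is taken in three copies, one for every position in a clause, so that the six tasks are always distinct;
  the copies of \<open>x\<^sub>j\<close> are constrained to be equal. Since clauses of three literals meet at most three
  groups, no sparsification is needed.

  There are \<open>3 (2^b + \<lceil>N / b\<rceil>)\<close> tasks, which is \<open>O(N / log N)\<close>.
\<close>

section \<open>Polynomially bounded computations on trees\<close>

text \<open>Natural coefficients make these polynomials monotone, so a bound on the size of an
  intermediate result can be substituted for that size.\<close>

inductive npoly :: "(nat \<Rightarrow> nat) \<Rightarrow> bool" where
  npoly_const: "npoly (\<lambda>_. c)"
| npoly_id: "npoly (\<lambda>n. n)"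
| npoly_add: "npoly p \<Longrightarrow> npoly q \<Longrightarrow> npoly (\<lambda>n. p n + q n)"
| npoly_mult: "npoly p \<Longrightarrow> npoly q \<Longrightarrow> npoly (\<lambda>n. p n * q n)"

lemma npoly_mono: "npoly p \<Longrightarrow> a \<le> b \<Longrightarrow> p a \<le> p b"
  by (induction rule: npoly.induct) (auto intro: add_mono mult_mono)

lemma npoly_comp: "npoly p \<Longrightarrow> npoly q \<Longrightarrow> npoly (\<lambda>n. p (q n))"
  by (induction rule: npoly.induct) (auto intro: npoly.intros)

lemma npoly_Suc: "npoly p \<Longrightarrow> npoly (\<lambda>n. Suc (p n))"
  using npoly_add[OF npoly_const[of 1]] by simp

lemmas npoly_intros = npoly.intros npoly_Suc

definition computes_at :: "nat \<Rightarrow> (val \<Rightarrow> val) \<Rightarrow> (nat \<Rightarrow> nat) \<Rightarrow> com \<Rightarrow> bool" where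
  "computes_at m f p P \<longleftrightarrow> (\<forall>s. \<exists>t s'. exec P s t s' \<and> s' m = f (s m) \<and>
     (\<forall>i<m. s' i = s i) \<and> t \<le> p (size (s m)))"

text \<open>Every register \<open>m\<close> can serve for input and output; the registers below \<open>m\<close> are preserved and
  those above are scratch space with arbitrary initial contents, so that programs compose. The size
  of the output is bounded separately because sharing lets trees grow exponentially in time.\<close>

definition ptime :: "(val \<Rightarrow> val) \<Rightarrow> bool" where
  "ptime f \<longleftrightarrow> (\<exists>p. npoly p \<and> (\<forall>x. size (f x) \<le> p (size x)) \<and> (\<forall>m. \<exists>P. computes_at m f p P))"

lemma computes_atI:
  assumes "\<And>s. \<exists>t s'. exec P s t s' \<and> s' m = f (s m) \<and> (\<forall>i<m. s' i = s i) \<and> t \<le> p (size (s m))"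
  shows "computes_at m f p P"
  using assms unfolding computes_at_def by blast

lemma computes_atE:
  assumes "computes_at m f p P"
  obtains t s' where "exec P s t s'" "s' m = f (s m)" "\<And>i. i < m \<Longrightarrow> s' i = s i" "t \<le> p (size (s m))"
  using assms unfolding computes_at_def by blast

lemma ptimeI:
  assumes "npoly p" "npoly q" "\<And>x. size (f x) \<le> q (size x)" "\<And>m. computes_at m f p (P m)"
  shows "ptime f"
proof -
  have "computes_at m f (\<lambda>n. p n + q n) (P m)" for m
    using assms(4)[of m] unfolding computes_at_def by (meson trans_le_add1)
  moreover have "size (f x) \<le> p (size x) + q (size x)" for x
    using assms(3)[of x] by simp
  ultimately show ?thesis
    unfolding ptime_def using npoly_add[OF assms(1,2)] by blast
qed

lemma ptimeE:
  assumes "ptime f"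
  obtains p P where "npoly p" "\<And>x. size (f x) \<le> p (size x)" "\<And>m. computes_at m f p (P m)"
  using assms unfolding ptime_def by metis

section \<open>Basic programs and their combination\<close>

lemma exec_Assign: "t = 1 + cost e \<Longrightarrow> s' = s(x := eval_expr e s) \<Longrightarrow> exec (Assign x e) s t s'"
  by (metis exec.Assign)

lemma ptime_id: "ptime (\<lambda>x. x)"
proof (rule ptimeI)
  show "computes_at m (\<lambda>x. x) (\<lambda>_. 1) Skip" for m
    unfolding computes_at_def using exec.Skip by blast
qed (auto intro: npoly_intros)

lemma ptime_comp:
  assumes "ptime f" "ptime g"
  shows "ptime (\<lambda>x. f (g x))"
proof -
  obtain p P where f: "npoly p" "\<And>x. size (f x) \<le> p (size x)" "\<And>m. computes_at m f p (P m)"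
    using assms(1) by (rule ptimeE) blast
  obtain q Q where g: "npoly q" "\<And>x. size (g x) \<le> q (size x)" "\<And>m. computes_at m g q (Q m)"
    using assms(2) by (rule ptimeE) blast
  have pg: "p (size (g x)) \<le> p (q (size x))" for x
    using f(1) g(2) by (rule npoly_mono)
  show ?thesis
  proof (rule ptimeI)
    show "computes_at m (\<lambda>x. f (g x)) (\<lambda>n. q n + p (q n)) (Seq (Q m) (P m))" for m
    proof (rule computes_atI)
      fix s :: state
      obtain t s' where 1: "exec (Q m) s t s'" "s' m = g (s m)" "\<And>i. i < m \<Longrightarrow> s' i = s i"
          "t \<le> q (size (s m))"
        using g(3)[of "m"] by (rule computes_atE[where s = s]) auto
      obtain u s'' where 2: "exec (P m) s' u s''" "s'' m = f (s' m)" "\<And>i. i < m \<Longrightarrow> s'' i = s' i"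
          "u \<le> p (size (s' m))"
        using f(3)[of "m"] by (rule computes_atE[where s = s']) auto
      show "\<exists>t s'. exec (Seq (Q m) (P m)) s t s' \<and> s' m = f (g (s m)) \<and> (\<forall>i<m. s' i = s i) \<and>
          t \<le> q (size (s m)) + p (q (size (s m)))"
        using exec.Seq[OF 1(1) 2(1)] 1(2-) 2(2-) pg[of "s m"]
        by (intro exI[of _ "t + u"] exI[of _ s'']) (auto intro!: add_mono)
    qed
    show "size (f (g x)) \<le> p (q (size x))" for x
      using f(2) pg le_trans by blast
  qed (auto intro!: npoly_intros npoly_comp[OF f(1)] g(1))
qed

lemma ptime_Nl: "ptime (\<lambda>_. Nl)"
proof (rule ptimeI)
  show "computes_at m (\<lambda>_. Nl) (\<lambda>_. 2) (Assign m NlE)" for m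
    by (rule computes_atI) (force intro!: exec_Assign)
qed (auto intro: npoly_intros)

lemma size_hd_val: "size (hd_val x) \<le> size x"
  by (cases x) auto

lemma size_tl_val: "size (tl_val x) \<le> size x"
  by (cases x) auto

lemma ptime_hd:
  assumes "ptime f"
  shows "ptime (\<lambda>x. hd_val (f x))"
proof -
  have "ptime hd_val"
  proof (rule ptimeI)
    show "computes_at m hd_val (\<lambda>_. 3) (Assign m (Hd (Var m)))" for m
      by (rule computes_atI) (force intro!: exec_Assign)
  qed (auto intro: npoly_intros size_hd_val)
  then show ?thesis using assms by (rule ptime_comp)
qed

lemma ptime_tl:
  assumes "ptime f"
  shows "ptime (\<lambda>x. tl_val (f x))"
proof -
  have "ptime tl_val"
  proof (rule ptimeI)
    show "computes_at m tl_val (\<lambda>_. 3) (Assign m (Tl (Var m)))" for m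
      by (rule computes_atI) (force intro!: exec_Assign)
  qed (auto intro: npoly_intros size_tl_val)
  then show ?thesis using assms by (rule ptime_comp)
qed

text \<open>The input is copied to registers \<open>m+1\<close> and \<open>m+2\<close>; the program
  for \<open>g\<close>, run at \<open>m+2\<close>, preserves the result of \<open>f\<close> in the
  lower register \<open>m+1\<close>.\<close>

lemma ptime_Pr:
  assumes "ptime f" "ptime g"
  shows "ptime (\<lambda>x. Pr (f x) (g x))"
proof -
  obtain p P where f: "npoly p" "\<And>x. size (f x) \<le> p (size x)" "\<And>m. computes_at m f p (P m)"
    using assms(1) by (rule ptimeE) blast
  obtain q Q where g: "npoly q" "\<And>x. size (g x) \<le> q (size x)" "\<And>m. computes_at m g q (Q m)"
    using assms(2) by (rule ptimeE) blast
  let ?R = "\<lambda>m. Seq (Assign (m+1) (Var m)) (Seq (P (m+1)) (Seq (Assign (m+2) (Var m)) (Seq (Q (m+2))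
    (Assign m (PrE (Var (m+1)) (Var (m+2)))))))"
  show ?thesis
  proof (rule ptimeI)
    show "computes_at m (\<lambda>x. Pr (f x) (g x)) (\<lambda>n. 8 + p n + q n) (?R m)" for m
    proof (rule computes_atI)
      fix s :: state
      let ?s1 = "s(m+1 := s m)"
      obtain t s2 where 2: "exec (P (m+1)) ?s1 t s2" "s2 (m+1) = f (s m)"
          "\<And>i. i < m+1 \<Longrightarrow> s2 i = s i" "t \<le> p (size (s m))"
        using f(3)[of "m+1"] by (rule computes_atE[where s = ?s1]) auto
      let ?s3 = "s2(m+2 := s m)"
      obtain u s4 where 4: "exec (Q (m+2)) ?s3 u s4" "s4 (m+2) = g (s m)"
          "\<And>i. i < m+2 \<Longrightarrow> s4 i = s2 i" "u \<le> q (size (s m))"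
        using g(3)[of "m+2"] by (rule computes_atE[where s = ?s3]) auto
      let ?s5 = "s4(m := Pr (f (s m)) (g (s m)))"
      have ex: "exec (?R m) s (2 + (t + (2 + (u + 4)))) ?s5"
        using 2 4
        by (intro exec.Seq[OF _ exec.Seq[OF _ exec.Seq[OF _ exec.Seq]]] exec_Assign)
          auto
      show "\<exists>t s'. exec (?R m) s t s' \<and> s' m = Pr (f (s m)) (g (s m)) \<and> (\<forall>i<m. s' i = s i) \<and>
          t \<le> 8 + p (size (s m)) + q (size (s m))"
        by (intro exI conjI, rule ex) (use 2(3,4) 4(3,4) in auto)
    qed
    show "size (Pr (f x) (g x)) \<le> Suc (p (size x) + q (size x))" for x
      using f(2)[of x] g(2)[of x] by simp
  qed (intro npoly_intros f g)+
qed

lemma ptime_const: "ptime (\<lambda>_. c)"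
  by (induction c) (auto intro: ptime_Nl ptime_Pr)

text \<open>The condition is evaluated on a copy in register \<open>m+1\<close>, so the input in
  \<open>m\<close> survives for the branch taken.\<close>

lemma ptime_if:
  assumes "ptime f" "ptime g" "ptime h"
  shows "ptime (\<lambda>x. if f x = Nl then g x else h x)"
proof -
  obtain p P where f: "npoly p" "\<And>x. size (f x) \<le> p (size x)" "\<And>m. computes_at m f p (P m)"
    using assms(1) by (rule ptimeE) blast
  obtain q Q where g: "npoly q" "\<And>x. size (g x) \<le> q (size x)" "\<And>m. computes_at m g q (Q m)"
    using assms(2) by (rule ptimeE) blast
  obtain r R where h: "npoly r" "\<And>x. size (h x) \<le> r (size x)" "\<And>m. computes_at m h r (R m)"
    using assms(3) by (rule ptimeE) blast
  let ?S = "\<lambda>m. Seq (Assign (m+1) (Var m)) (Seq (P (m+1)) (If (Var (m+1)) (R m) (Q m)))"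
  show ?thesis
  proof (rule ptimeI)
    show "computes_at m (\<lambda>x. if f x = Nl then g x else h x) (\<lambda>n. 4 + p n + q n + r n) (?S m)" for m
    proof (rule computes_atI)
      fix s :: state
      let ?s1 = "s(m+1 := s m)"
      obtain t s2 where 2: "exec (P (m+1)) ?s1 t s2" "s2 (m+1) = f (s m)"
          "\<And>i. i < m+1 \<Longrightarrow> s2 i = s i" "t \<le> p (size (s m))"
        using f(3)[of "m+1"] by (rule computes_atE[where s = ?s1]) auto
      obtain u s3 where 3: "exec (Q m) s2 u s3" "s3 m = g (s m)"
          "\<And>i. i < m \<Longrightarrow> s3 i = s2 i" "u \<le> q (size (s m))"
        using g(3)[of "m"] by (rule computes_atE[where s = s2]) (auto simp: 2(3))
      obtain v s4 where 4: "exec (R m) s2 v s4" "s4 m = h (s m)"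
          "\<And>i. i < m \<Longrightarrow> s4 i = s2 i" "v \<le> r (size (s m))"
        using h(3)[of "m"] by (rule computes_atE[where s = s2]) (auto simp: 2(3))
      have 1: "exec (Assign (m+1) (Var m)) s 2 ?s1"
        by (rule exec_Assign) auto
      show "\<exists>t s'. exec (?S m) s t s' \<and> s' m = (if f (s m) = Nl then g (s m) else h (s m)) \<and>
          (\<forall>i<m. s' i = s i) \<and> t \<le> 4 + p (size (s m)) + q (size (s m)) + r (size (s m))"
      proof (cases "f (s m) = Nl")
        case True
        then have "exec (If (Var (m+1)) (R m) (Q m)) s2 (1 + cost (Var (m+1)) + u) s3"
          using 2(2) 3(1) by (intro exec.IfFalse) auto
        note ex = exec.Seq[OF 1 exec.Seq[OF 2(1) this]]
        show ?thesis
          by (intro exI conjI, rule ex) (use True 2 3 in auto)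
      next
        case False
        then have "exec (If (Var (m+1)) (R m) (Q m)) s2 (1 + cost (Var (m+1)) + v) s4"
          using 2(2) 4(1) by (intro exec.IfTrue) auto
        note ex = exec.Seq[OF 1 exec.Seq[OF 2(1) this]]
        show ?thesis
          by (intro exI conjI, rule ex) (use False 2 4 in auto)
      qed
    qed
    show "size (if f x = Nl then g x else h x) \<le> q (size x) + r (size x)" for x
      using g(2)[of x] h(2)[of x] by simp
  qed (intro npoly_intros f g h)+
qed

section \<open>Folds over lists as loops\<close>

fun vlen :: "val \<Rightarrow> nat" where
  "vlen Nl = 0"
| "vlen (Pr a l) = Suc (vlen l)"

fun vfold :: "(val \<Rightarrow> val \<Rightarrow> val) \<Rightarrow> val \<Rightarrow> val \<Rightarrow> val" where
  "vfold F a Nl = a"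
| "vfold F a (Pr e l) = vfold F (F e a) l"

lemma vlen_le_size: "vlen l \<le> size l"
  by (induction l) auto

text \<open>Register \<open>m\<close> holds a parameter, \<open>m+1\<close> the rest of the list,
  \<open>m+2\<close> the accumulator and \<open>m+3\<close> the triple handed to the body
  \<open>Q\<close>. \<open>Inv i a\<close> describes the accumulator after \<open>i\<close> rounds;
  \<open>A\<close> bounds its size throughout and hence the time of each call of
  \<open>Q\<close>.\<close>

lemma exec_fold_loop:
  fixes m :: nat
  defines "W \<equiv> \<lambda>Q. While (Var (m+1)) (Seq (Assign (m+3) (PrE (Var m) (PrE (Hd (Var (m+1))) (Var (m+2)))))
     (Seq Q (Seq (Assign (m+2) (Var (m+3))) (Assign (m+1) (Tl (Var (m+1)))))))"
  assumes Q: "computes_at (m+3) (\<lambda>z. F (hd_val z) (hd_val (tl_val z)) (tl_val (tl_val z))) p Q"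
    and p: "npoly p"
    and step: "\<And>i e a. Inv i a \<Longrightarrow> size e \<le> L \<Longrightarrow> Inv (Suc i) (F (s m) e a)"
    and bnd: "\<And>i a. Inv i a \<Longrightarrow> i \<le> n \<Longrightarrow> size a \<le> A"
    and L: "size (s (m+1)) \<le> L"
    and n: "i + vlen (s (m+1)) \<le> n"
    and inv: "Inv i (s (m+2))"
  shows "\<exists>t s'. exec (W Q) s t s' \<and> s' (m+2) = vfold (F (s m)) (s (m+2)) (s (m+1)) \<and>
     (\<forall>j\<le>m. s' j = s j) \<and> t \<le> 2 + vlen (s (m+1)) * (17 + p (2 + size (s m) + L + A))"
  using step L n inv
proof (induction "s (m+1)" arbitrary: s i)
  case Nl
  then have "exec (W Q) s (1 + cost (Var (m+1))) s"
    unfolding W_def by (intro exec.WhileFalse) auto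
  with Nl show ?case by (intro exI conjI) (auto simp flip: Nl(1))
next
  case (Pr e l)
  have sl: "s (m+1) = Pr e l" using Pr(3) by simp
  then have e: "hd_val (s (m+1)) = e" "tl_val (s (m+1)) = l" "s (m+1) \<noteq> Nl"
    by simp_all
  let ?z = "Pr (s m) (Pr e (s (m+2)))"
  let ?s1 = "s(m+3 := ?z)"
  obtain t s2 where 2: "exec Q ?s1 t s2" "s2 (m+3) = F (s m) e (s (m+2))"
      "\<And>j. j < m+3 \<Longrightarrow> s2 j = ?s1 j" "t \<le> p (size ?z)"
    using Q by (rule computes_atE[where s = ?s1]) auto
  let ?s4 = "s2(m+2 := F (s m) e (s (m+2)), m+1 := l)"
  have body: "exec (Seq (Assign (m+3) (PrE (Var m) (PrE (Hd (Var (m+1))) (Var (m+2)))))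
     (Seq Q (Seq (Assign (m+2) (Var (m+3))) (Assign (m+1) (Tl (Var (m+1))))))) s
     (7 + (t + (2 + 3))) ?s4"
    using 2 e by (intro exec.Seq[OF _ exec.Seq[OF _ exec.Seq]] exec_Assign) auto
  have sz: "size e \<le> L" "size l \<le> L" "vlen (s (m+1)) = Suc (vlen l)"
    using Pr(5) unfolding sl by simp_all
  have eqs: "?s4 m = s m" "?s4 (m+1) = l" "?s4 (m+2) = F (s m) e (s (m+2))"
    using 2(3)[of m] by auto
  have "\<exists>t s'. exec (W Q) ?s4 t s' \<and> s' (m+2) = vfold (F (?s4 m)) (?s4 (m+2)) (?s4 (m+1)) \<and>
     (\<forall>j\<le>m. s' j = ?s4 j) \<and> t \<le> 2 + vlen (?s4 (m+1)) * (17 + p (2 + size (?s4 m) + L + A))"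
  proof (rule Pr(2))
    show "l = ?s4 (m+1)" by simp
    show "Inv (Suc j) (F (?s4 m) e a)" if "Inv j a" "size e \<le> L" for j e a
      using Pr(4) that unfolding eqs by blast
    show "size (?s4 (m+1)) \<le> L" using sz by simp
    show "Suc i + vlen (?s4 (m+1)) \<le> n" using Pr(6) sz by simp
    show "Inv (Suc i) (?s4 (m+2))" using Pr(4)[OF Pr(7) sz(1)] by simp
  qed
  then obtain u s5 where 5: "exec (W Q) ?s4 u s5"
      "s5 (m+2) = vfold (F (s m)) (F (s m) e (s (m+2))) l" "\<And>j. j \<le> m \<Longrightarrow> s5 j = ?s4 j"
      "u \<le> 2 + vlen l * (17 + p (2 + size (s m) + L + A))"
    unfolding eqs by blast
  have "exec (W Q) s (1 + cost (Var (m+1)) + (7 + (t + (2 + 3))) + u) s5"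
    unfolding W_def by (rule exec.WhileTrue) (use e body 5(1) in \<open>auto simp: W_def\<close>)
  moreover have "t \<le> p (2 + size (s m) + L + A)"
    by (rule le_trans[OF 2(4) npoly_mono[OF p]])
      (use bnd[OF Pr(7)] Pr(6) sz(1) in auto)
  then have "1 + cost (Var (m+1)) + (7 + (t + (2 + 3))) + u
      \<le> 2 + vlen (s (m+1)) * (17 + p (2 + size (s m) + L + A))"
    using 5(4) unfolding sz(3) by simp
  moreover have "vfold (F (s m)) (F (s m) e (s (m+2))) l = vfold (F (s m)) (s (m+2)) (s (m+1))"
    unfolding sl by simp
  ultimately show ?case using 5(2,3) 2(3)
    by (intro exI[of _ "1 + cost (Var (m+1)) + (7 + (t + (2 + 3))) + u"] exI[of _ s5]) auto
qed

text \<open>Even a polynomial-time body could double the accumulator in every round. The invariant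
  excludes this: whatever is reached within \<open>vlen (l x)\<close> rounds has polynomial
  size.\<close>

lemma ptime_vfold_inv:
  assumes "ptime (\<lambda>z. F (hd_val z) (hd_val (tl_val z)) (tl_val (tl_val z)))" "ptime a" "ptime l"
    and init: "\<And>x. Inv x 0 (a x)"
    and step: "\<And>x i e b. Inv x i b \<Longrightarrow> size e \<le> size (l x) \<Longrightarrow> Inv x (Suc i) (F x e b)"
    and q: "npoly q"
    and bnd: "\<And>x i b. Inv x i b \<Longrightarrow> i \<le> vlen (l x) \<Longrightarrow> size b \<le> q (size x)"
  shows "ptime (\<lambda>x. vfold (F x) (a x) (l x))"
proof -
  let ?f = "\<lambda>z. F (hd_val z) (hd_val (tl_val z)) (tl_val (tl_val z))"
  obtain pf F' where f: "npoly pf" "\<And>x. size (?f x) \<le> pf (size x)" "\<And>m. computes_at m ?f pf (F' m)"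
    using assms(1) by (rule ptimeE) blast
  obtain pa A where a: "npoly pa" "\<And>x. size (a x) \<le> pa (size x)" "\<And>m. computes_at m a pa (A m)"
    using assms(2) by (rule ptimeE) blast
  obtain pl L where l: "npoly pl" "\<And>x. size (l x) \<le> pl (size x)" "\<And>m. computes_at m l pl (L m)"
    using assms(3) by (rule ptimeE) blast
  let ?W = "\<lambda>m. While (Var (m+1)) (Seq (Assign (m+3) (PrE (Var m) (PrE (Hd (Var (m+1))) (Var (m+2)))))
     (Seq (F' (m+3)) (Seq (Assign (m+2) (Var (m+3))) (Assign (m+1) (Tl (Var (m+1)))))))"
  let ?R = "\<lambda>m. Seq (Assign (m+1) (Var m)) (Seq (L (m+1)) (Seq (Assign (m+2) (Var m)) (Seq (A (m+2))
    (Seq (?W m) (Assign m (Var (m+2)))))))"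
  let ?p = "\<lambda>n. 8 + pl n + pa n + pl n * (17 + pf (2 + n + pl n + q n))"
  show ?thesis
  proof (rule ptimeI)
    show "computes_at m (\<lambda>x. vfold (F x) (a x) (l x)) ?p (?R m)" for m
    proof (rule computes_atI)
      fix s :: state
      let ?s1 = "s(m+1 := s m)"
      obtain t s2 where 2: "exec (L (m+1)) ?s1 t s2" "s2 (m+1) = l (s m)"
          "\<And>i. i < m+1 \<Longrightarrow> s2 i = s i" "t \<le> pl (size (s m))"
        using l(3)[of "m+1"] by (rule computes_atE[where s = ?s1]) auto
      let ?s3 = "s2(m+2 := s m)"
      obtain u s4 where 4: "exec (A (m+2)) ?s3 u s4" "s4 (m+2) = a (s m)"
          "\<And>i. i < m+2 \<Longrightarrow> s4 i = s2 i" "u \<le> pa (size (s m))"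
        using a(3)[of "m+2"] by (rule computes_atE[where s = ?s3]) auto
      have s4: "s4 (m+1) = l (s m)" "s4 m = s m" using 4(3) 2(2,3) by simp_all
      have "\<exists>t s'. exec (?W m) s4 t s' \<and> s' (m+2) = vfold (F (s4 m)) (s4 (m+2)) (s4 (m+1)) \<and>
         (\<forall>j\<le>m. s' j = s4 j) \<and> t \<le> 2 + vlen (s4 (m+1)) *
           (17 + pf (2 + size (s4 m) + size (l (s m)) + q (size (s m))))"
      proof (rule exec_fold_loop[OF f(3) f(1), where Inv = "Inv (s m)" and i = 0
            and n = "vlen (l (s m))"])
      qed (use step bnd init s4 4(2) in auto)
      then obtain v s5 where 5: "exec (?W m) s4 v s5" "s5 (m+2) = vfold (F (s m)) (a (s m)) (l (s m))"
         "\<And>j. j \<le> m \<Longrightarrow> s5 j = s4 j" "v \<le> 2 + vlen (l (s m)) *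
           (17 + pf (2 + size (s m) + size (l (s m)) + q (size (s m))))"
        unfolding s4 4(2) by blast
      let ?s6 = "s5(m := s5 (m+2))"
      have ex: "exec (?R m) s (2 + (t + (2 + (u + (v + 2))))) ?s6"
        using 2 4 5(1)
        by (intro exec.Seq[OF _ exec.Seq[OF _ exec.Seq[OF _ exec.Seq[OF _ exec.Seq]]]] exec_Assign)
          auto
      have le: "vlen (l (s m)) * (17 + pf (2 + size (s m) + size (l (s m)) + q (size (s m))))
          \<le> pl (size (s m)) * (17 + pf (2 + size (s m) + pl (size (s m)) + q (size (s m))))"
        by (intro mult_le_mono add_left_mono npoly_mono[OF f(1)] add_right_mono l(2)
            le_trans[OF vlen_le_size l(2)])
      show "\<exists>t s'. exec (?R m) s t s' \<and> s' m = vfold (F (s m)) (a (s m)) (l (s m)) \<and>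
          (\<forall>i<m. s' i = s i) \<and> t \<le> ?p (size (s m))"
        by (intro exI conjI, rule ex) (use le 2(3,4) 4(3,4) 5(2-) in auto)
    qed
    show "size (vfold (F x) (a x) (l x)) \<le> q (size x)" for x
    proof -
      have "size (vfold (F x) b k) \<le> q (size x)"
        if "size k \<le> size (l x)" "i + vlen k \<le> vlen (l x)" "Inv x i b" for k i b
        using that
      proof (induction k arbitrary: i b)
        case Nl
        then show ?case using bnd by simp
      next
        case (Pr e k)
        show ?case using Pr(2)[of "Suc i" "F x e b"] Pr(3-) step by simp
      qed
      from this[of "l x" 0 "a x"] init show ?thesis by simp
    qed
  qed (intro npoly_intros npoly_comp[OF f(1)] a l q)+
qed

text \<open>If the growth in one round is bounded independently of the accumulator, the total growth
  is at most that bound times the number of rounds, and this serves as invariant.\<close>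

lemma ptime_vfold:
  assumes "ptime (\<lambda>z. F (hd_val z) (hd_val (tl_val z)) (tl_val (tl_val z)))" "ptime a" "ptime l"
    and q: "npoly q"
    and grow: "\<And>x e b. size (F x e b) \<le> size b + q (size x + size e)"
  shows "ptime (\<lambda>x. vfold (F x) (a x) (l x))"
proof -
  obtain pa A where a: "npoly pa" "\<And>x. size (a x) \<le> pa (size x)" "\<And>m. computes_at m a pa (A m)"
    using assms(2) by (rule ptimeE) blast
  obtain pl L where l: "npoly pl" "\<And>x. size (l x) \<le> pl (size x)" "\<And>m. computes_at m l pl (L m)"
    using assms(3) by (rule ptimeE) blast
  show ?thesis
  proof (rule ptime_vfold_inv[where
        Inv = "\<lambda>x i b. size b \<le> size (a x) + i * q (size x + size (l x))" and
        q = "\<lambda>n. pa n + pl n * q (n + pl n)"])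
    fix x i and e b :: val
    assume "size b \<le> size (a x) + i * q (size x + size (l x))" "size e \<le> size (l x)"
    moreover from this have "q (size x + size e) \<le> q (size x + size (l x))"
      by (intro npoly_mono[OF q]) simp
    ultimately show "size (F x e b) \<le> size (a x) + Suc i * q (size x + size (l x))"
      using grow[of x e b] by simp
  next
    fix x i and b :: val
    assume b: "size b \<le> size (a x) + i * q (size x + size (l x))" "i \<le> vlen (l x)"
    note b(1)
    also have "size (a x) + i * q (size x + size (l x)) \<le> pa (size x) + pl (size x) * q (size x + pl (size x))"
      by (intro add_mono mult_le_mono npoly_mono[OF q] l(2) order_refl a(2)
          le_trans[OF b(2) le_trans[OF vlen_le_size l(2)]])
    finally show "size b \<le> pa (size x) + pl (size x) * q (size x + pl (size x))" .
  qed (auto intro!: assms npoly_intros npoly_comp[OF q] a l)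
qed

section \<open>Lists as trees\<close>

named_theorems ptime_intros

declare ptime_id [ptime_intros] ptime_hd [ptime_intros] ptime_tl [ptime_intros]
  ptime_Pr [ptime_intros] ptime_const [ptime_intros] ptime_if [ptime_intros]

fun vappend :: "val \<Rightarrow> val \<Rightarrow> val" where
  "vappend Nl b = b"
| "vappend (Pr e a) b = Pr e (vappend a b)"

fun vbind :: "(val \<Rightarrow> val) \<Rightarrow> val \<Rightarrow> val" where
  "vbind F Nl = Nl"
| "vbind F (Pr e l) = vappend (F e) (vbind F l)"

definition vmap :: "(val \<Rightarrow> val) \<Rightarrow> val \<Rightarrow> val" where
  "vmap F = vbind (\<lambda>e. Pr (F e) Nl)"

text \<open>On unary numbers this is truncated subtraction, which also serves for comparison; on
  lists, the head of the result is the entry of \<open>a\<close> at position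
  \<open>b\<close>.\<close>

definition vsub :: "val \<Rightarrow> val \<Rightarrow> val" where
  "vsub a b = vfold (\<lambda>_. tl_val) a b"

definition vupt :: "val \<Rightarrow> val" where
  "vupt = vfold (\<lambda>_ l. Pr Nl (vmap (Pr Nl) l)) Nl"

definition vblank :: "val \<Rightarrow> val" where
  "vblank = vmap (\<lambda>_. Nl)"

definition vprod :: "val \<Rightarrow> val \<Rightarrow> val" where
  "vprod a b = vbind (\<lambda>x. vmap (Pr x) b) a"

lemma size_vappend: "size (vappend a b) = size a + size b"
  by (induction a) auto

lemma vappend_assoc: "vappend (vappend a b) c = vappend a (vappend b c)"
  by (induction a) auto

lemma vfold_Pr_vfold_Pr: "vfold Pr b (vfold Pr c a) = vfold Pr (vappend a b) c"
  by (induction a arbitrary: c) auto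

text \<open>Folding \<open>Pr\<close> pushes the entries onto the accumulator and so reverses them;
  reversing twice restores the order of \<open>a\<close>.\<close>

lemma vappend_eq_vfold: "vappend a b = vfold Pr b (vfold Pr Nl a)"
  by (simp add: vfold_Pr_vfold_Pr)

text \<open>A fold consumes a list from the front while \<open>vbind\<close> joins its pieces from
  the back, so the list is reversed first.\<close>

lemma vbind_eq_vfold: "vbind F l = vfold (\<lambda>e. vappend (F e)) Nl (vfold Pr Nl l)"
proof -
  have "vfold (\<lambda>e. vappend (F e)) b (vfold Pr c l) = vfold (\<lambda>e. vappend (F e)) (vappend (vbind F l) b) c"
    for b c
    by (induction l arbitrary: c) (auto simp: vappend_assoc)
  moreover have "vappend a Nl = a" for a
    by (induction a) auto
  ultimately show ?thesis by simp
qed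

section \<open>Polynomial time of the list operations\<close>

lemma ptime_vfold_Pr:
  assumes "ptime a" "ptime l"
  shows "ptime (\<lambda>x. vfold Pr (a x) (l x))"
proof (rule ptime_vfold[where F = "\<lambda>_. Pr" and q = "\<lambda>n. Suc n"])
qed (auto intro!: ptime_intros npoly_intros assms)

lemma ptime_vappend [ptime_intros]:
  assumes "ptime f" "ptime g"
  shows "ptime (\<lambda>x. vappend (f x) (g x))"
  unfolding vappend_eq_vfold by (intro ptime_vfold_Pr ptime_intros assms)

lemma ptime_vbind [ptime_intros]:
  assumes F: "ptime (\<lambda>z. F (hd_val z) (tl_val z))" and l: "ptime l"
  shows "ptime (\<lambda>x. vbind (F x) (l x))"
proof -
  obtain p P where p: "npoly p" "\<And>x. size (F (hd_val x) (tl_val x)) \<le> p (size x)"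
      "\<And>m. computes_at m (\<lambda>z. F (hd_val z) (tl_val z)) p (P m)"
    using F by (rule ptimeE) blast
  \<comment> \<open>The body of a fold also receives the accumulator, which is discarded before
    \<open>F\<close> applies.\<close>
  have F': "ptime (\<lambda>z. F (hd_val z) (hd_val (tl_val z)))"
    using ptime_comp[OF F, of "\<lambda>z. Pr (hd_val z) (hd_val (tl_val z))"]
    by (simp add: ptime_intros)
  show ?thesis
    unfolding vbind_eq_vfold
  proof (rule ptime_vfold[where F = "\<lambda>x e. vappend (F x e)" and q = "\<lambda>n. p (Suc n)"])
    show "size (vappend (F x e) b) \<le> size b + p (Suc (size x + size e))" for x e b
      using p(2)[of "Pr x e"] by (simp add: size_vappend)
  qed (intro ptime_intros ptime_vfold_Pr F' l npoly_comp[OF p(1)] npoly_intros)+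
qed

lemma ptime_vmap [ptime_intros]:
  assumes "ptime (\<lambda>z. F (hd_val z) (tl_val z))" "ptime l"
  shows "ptime (\<lambda>x. vmap (F x) (l x))"
  unfolding vmap_def by (intro ptime_intros assms)

lemma ptime_vsub [ptime_intros]:
  assumes "ptime f" "ptime g"
  shows "ptime (\<lambda>x. vsub (f x) (g x))"
  unfolding vsub_def
proof (rule ptime_vfold[where q = "\<lambda>_. 0"])
qed (auto intro!: ptime_intros npoly_intros assms size_tl_val)

lemma ptime_vblank [ptime_intros]:
  assumes "ptime f"
  shows "ptime (\<lambda>x. vblank (f x))"
  unfolding vblank_def by (intro ptime_intros assms)

lemma ptime_vprod [ptime_intros]:
  assumes "ptime f" "ptime g"
  shows "ptime (\<lambda>x. vprod (f x) (g x))"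
  unfolding vprod_def by (intro ptime_intros assms assms[THEN ptime_comp])

section \<open>Values of the list operations on encodings\<close>

lemma vappend_enc_list: "vappend (enc_list f xs) (enc_list f ys) = enc_list f (xs @ ys)"
  by (induction xs) auto

lemma vbind_enc_list:
  "(\<And>x. x \<in> set xs \<Longrightarrow> F (f x) = enc_list g (G x)) \<Longrightarrow>
    vbind F (enc_list f xs) = enc_list g (concat (map G xs))"
  by (induction xs) (auto simp: vappend_enc_list)

lemma vmap_enc_list:
  "(\<And>x. x \<in> set xs \<Longrightarrow> F (f x) = g (G x)) \<Longrightarrow> vmap F (enc_list f xs) = enc_list g (map G xs)"
  unfolding vmap_def by (induction xs) auto

lemma enc_list_eq_Nl_iff: "enc_list f xs = Nl \<longleftrightarrow> xs = []"
  by (cases xs) auto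

lemma enc_list_map: "enc_list f (map g xs) = enc_list (\<lambda>x. f (g x)) xs"
  by (induction xs) auto

lemma vbind_filter_enc_list:
  assumes "\<And>x. x \<in> set xs \<Longrightarrow> F (f x) = (if P x then Pr (g x) Nl else Nl)"
  shows "vbind F (enc_list f xs) = enc_list g (filter P xs)"
proof -
  have "vbind F (enc_list f xs) = enc_list g (concat (map (\<lambda>x. if P x then [x] else []) xs))"
    by (rule vbind_enc_list) (simp add: assms)
  also have "concat (map (\<lambda>x. if P x then [x] else []) xs) = filter P xs"
    by (induction xs) auto
  finally show ?thesis .
qed

lemma vprod_enc_list:
  "vprod (enc_list f xs) (enc_list g ys) = enc_list (\<lambda>(x, y). Pr (f x) (g y)) (List.product xs ys)"
  unfolding vprod_def product_concat_map by (intro vbind_enc_list vmap_enc_list) auto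

lemma vprod_enc_list_Cons:
  "vprod (enc_list f xs) (enc_list (enc_list f) yss) =
     enc_list (enc_list f) (concat (map (\<lambda>x. map (Cons x) yss) xs))"
  unfolding vprod_def by (intro vbind_enc_list vmap_enc_list) auto

lemma enc_list_const: "enc_list (\<lambda>_. c) xs = enc_list (\<lambda>_. c) ys \<longleftrightarrow> length xs = length ys"
proof (induction xs arbitrary: ys)
  case (Cons x xs)
  then show ?case by (cases ys) auto
qed (auto simp: enc_list_eq_Nl_iff dest: sym)

lemma enc_nat_length: "enc_list (\<lambda>_. Nl) xs = enc_nat (length xs)"
  unfolding enc_nat_def by (simp add: enc_list_const)

lemma enc_nat_0: "enc_nat 0 = Nl"
  by (simp add: enc_nat_def)

lemma enc_nat_Suc: "enc_nat (Suc n) = Pr Nl (enc_nat n)"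
  using enc_nat_length[of "0 # [0..<n]"] enc_nat_length[of "[0..<n]"] by simp

lemma enc_nat_eq_Nl_iff: "enc_nat n = Nl \<longleftrightarrow> n = 0"
  by (simp add: enc_nat_def enc_list_eq_Nl_iff)

lemma vlen_enc_nat: "vlen (enc_nat n) = n"
  by (induction n) (auto simp: enc_nat_0 enc_nat_Suc)

lemma size_enc_nat: "size (enc_nat n) = n"
  by (induction n) (auto simp: enc_nat_0 enc_nat_Suc)

lemma vappend_enc_nat: "vappend (enc_nat a) (enc_nat b) = enc_nat (a + b)"
  by (induction a) (auto simp: enc_nat_0 enc_nat_Suc)

lemma vblank_enc_list: "vblank (enc_list f xs) = enc_nat (length xs)"
  unfolding vblank_def by (subst vmap_enc_list[where g = "\<lambda>_. Nl"]) (simp_all add: enc_nat_length)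

lemma vsub_enc_list: "vsub (enc_list f xs) b = enc_list f (drop (vlen b) xs)"
proof (unfold vsub_def, induction b arbitrary: xs)
  case (Pr c b)
  show ?case using Pr(2)[of "tl xs"] by (cases xs) auto
qed auto

lemma vsub_enc_nat: "vsub (enc_nat a) b = enc_nat (a - vlen b)"
  using vsub_enc_list[of "\<lambda>_. Nl" "[0..<a]" b] by (simp add: enc_nat_length)

lemma vsub_eq_Nl_iff: "vsub a b = Nl \<longleftrightarrow> vlen a \<le> vlen b"
proof (unfold vsub_def, induction b arbitrary: a)
  case Nl
  then show ?case by (cases a) auto
next
  case (Pr c b)
  then show ?case by (cases a) auto
qed

lemma vupt_step: "Pr Nl (vmap (Pr Nl) (enc_list enc_nat [0..<n])) = enc_list enc_nat [0..<Suc n]"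
proof -
  have "vmap (Pr Nl) (enc_list enc_nat [0..<n]) = enc_list enc_nat (map Suc [0..<n])"
    by (rule vmap_enc_list) (simp add: enc_nat_Suc)
  then show ?thesis
    by (simp add: map_Suc_upt upt_conv_Cons enc_nat_0 del: upt_Suc)
qed

lemma vfold_vupt:
  "vfold (\<lambda>_ l. Pr Nl (vmap (Pr Nl) l)) (enc_list enc_nat [0..<n]) x = enc_list enc_nat [0..<n + vlen x]"
  by (induction x arbitrary: n) (simp_all add: vupt_step del: upt_Suc)

lemma vupt_eq: "vupt x = enc_list enc_nat [0..<vlen x]"
  unfolding vupt_def using vfold_vupt[of 0] by simp

lemma size_enc_list_le:
  "(\<And>x. x \<in> set xs \<Longrightarrow> size (f x) \<le> c) \<Longrightarrow> size (enc_list f xs) \<le> length xs * Suc c"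
  by (induction xs) force+

text \<open>A round increments every number collected so far, so its growth depends on the
  accumulator; the exact contents serve as invariant instead.\<close>

lemma ptime_vupt [ptime_intros]:
  assumes "ptime f"
  shows "ptime (\<lambda>x. vupt (f x))"
proof (rule ptime_comp[OF _ assms])
  show "ptime vupt"
    unfolding vupt_def
  proof (rule ptime_vfold_inv[where Inv = "\<lambda>x i b. b = enc_list enc_nat [0..<i]"
        and q = "\<lambda>n. n * Suc n" and l = "\<lambda>x. x"])
    fix x b :: val and i
    assume b: "b = enc_list enc_nat [0..<i]" and i: "i \<le> vlen x"
    then have "i \<le> size x" using vlen_le_size le_trans by blast
    have "size b \<le> i * Suc i"
      unfolding b by (rule le_trans[OF size_enc_list_le[where c = i]]) (auto simp: size_enc_nat)
    also have "\<dots> \<le> size x * Suc (size x)"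
      using \<open>i \<le> size x\<close> by (intro mult_mono) auto
    finally show "size b \<le> size x * Suc (size x)" .
  qed (auto simp: vupt_step simp del: upt_Suc intro!: ptime_intros npoly_intros)
qed

section \<open>Bit words\<close>

fun words :: "nat \<Rightarrow> bool list list" where
  "words 0 = [[]]"
| "words (Suc b) = map (Cons False) (words b) @ map (Cons True) (words b)"

lemma length_words: "length (words b) = 2 ^ b"
  by (induction b) auto

lemma set_words: "set (words b) = {w. length w = b}"
  by (induction b) (auto simp: length_Suc_conv image_iff)

text \<open>The extra \<open>Pr\<close> makes either bit differ from \<open>Nl\<close>, which is
  reserved for positions without a value.\<close>

definition enc_words :: "nat \<Rightarrow> val" where
  "enc_words b = enc_list (enc_list (\<lambda>c. Pr Nl (enc_bool c))) (words b)"

definition vdouble :: "val \<Rightarrow> val" where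
  "vdouble B = vappend (vmap (Pr (Pr Nl (enc_bool False))) B) (vmap (Pr (Pr Nl (enc_bool True))) B)"

lemma ptime_vdouble [ptime_intros]:
  assumes "ptime f"
  shows "ptime (\<lambda>x. vdouble (f x))"
  unfolding vdouble_def by (intro ptime_intros assms)

lemma vdouble_enc_words: "vdouble (enc_words b) = enc_words (Suc b)"
proof -
  let ?e = "\<lambda>c. Pr Nl (enc_bool c)"
  have "vmap (Pr (?e c)) (enc_words b) = enc_list (enc_list ?e) (map (Cons c) (words b))" for c
    unfolding enc_words_def by (rule vmap_enc_list) simp
  then show ?thesis
    unfolding vdouble_def by (simp add: vappend_enc_list enc_words_def)
qed

text \<open>If \<open>B\<close> lists the words of length \<open>b\<close>, the product of
  \<open>vdouble B\<close> with itself has \<open>4 ^ Suc b\<close> entries; comparing it with the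
  unary number \<open>N\<close> decides whether the words may get longer.\<close>

definition vwstep :: "val \<Rightarrow> val \<Rightarrow> val" where
  "vwstep N B = (if vsub (vprod (vdouble B) (vdouble B)) N = Nl then vdouble B else B)"

definition vwords :: "val \<Rightarrow> val" where
  "vwords N = vfold (\<lambda>_. vwstep N) (enc_words 1) N"

definition wstep :: "nat \<Rightarrow> nat \<Rightarrow> nat" where
  "wstep N b = (if 4 ^ Suc b \<le> N then Suc b else b)"

text \<open>\<open>wlen N\<close> is the largest \<open>b\<close> with \<open>4 ^ b \<le> N\<close> if this is positive, and \<open>1\<close> otherwise.\<close>

definition wlen :: "nat \<Rightarrow> nat" where
  "wlen N = (wstep N ^^ N) 1"

lemma vlen_enc_list: "vlen (enc_list f xs) = length xs"
  by (induction xs) auto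

lemma vwstep_enc_words: "vwstep N (enc_words b) = enc_words (wstep (vlen N) b)"
proof -
  have "vlen (vprod (enc_words c) (enc_words c)) = 4 ^ c" for c
    unfolding enc_words_def
    by (simp add: vprod_enc_list vlen_enc_list length_words flip: power_mult_distrib)
  then show ?thesis
    unfolding vwstep_def wstep_def vdouble_enc_words vsub_eq_Nl_iff by simp
qed

lemma vwords_eq: "vwords N = enc_words (wlen (vlen N))"
proof -
  have "vfold (\<lambda>_. vwstep N) (enc_words b) x = enc_words ((wstep (vlen N) ^^ vlen x) b)" for b x
    by (induction x arbitrary: b) (simp_all add: vwstep_enc_words funpow_swap1)
  then show ?thesis unfolding vwords_def wlen_def by blast
qed

lemma size_enc_words: "size (enc_words b) \<le> 2 ^ b * Suc (b * 3)"
  unfolding enc_words_def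
proof (rule le_trans[OF size_enc_list_le[where c = "b * 3"]])
  show "size (enc_list (\<lambda>c. Pr Nl (enc_bool c)) w) \<le> b * 3" if "w \<in> set (words b)" for w
    using that size_enc_list_le[of w "\<lambda>c. Pr Nl (enc_bool c)" 2]
    by (auto simp: set_words enc_bool_def)
qed (simp add: length_words)

lemma less_4_power: "b < 4 ^ (b::nat)"
  by (induction b) auto

text \<open>Successful rounds double the list, but only while \<open>4 ^ b\<close> is at most the
  unary input, which keeps \<open>2 ^ b\<close> polynomial. The summand 8 bounds the size of the
  initial list, where \<open>b = 1\<close>.\<close>

lemma ptime_vwords [ptime_intros]:
  assumes "ptime f"
  shows "ptime (\<lambda>x. vwords (f x))"
proof (rule ptime_comp[OF _ assms])
  show "ptime vwords"
    unfolding vwords_def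
  proof (rule ptime_vfold_inv[where F = "\<lambda>x _. vwstep x"
        and Inv = "\<lambda>x i B. \<exists>b. B = enc_words b \<and> (b = 1 \<or> 4 ^ b \<le> vlen x)"
        and q = "\<lambda>n. 8 + n * Suc (n * 3)" and l = "\<lambda>x. x"])
    show "ptime (\<lambda>z. vwstep (hd_val z) (tl_val (tl_val z)))"
      unfolding vwstep_def by (intro ptime_intros)
  next
    fix x B e :: val and i
    assume "\<exists>b. B = enc_words b \<and> (b = 1 \<or> 4 ^ b \<le> vlen x)"
    then obtain b where "B = enc_words b" "b = 1 \<or> 4 ^ b \<le> vlen x" by blast
    then show "\<exists>b. vwstep x B = enc_words b \<and> (b = 1 \<or> 4 ^ b \<le> vlen x)"
      by (intro exI[of _ "wstep (vlen x) b"]) (auto simp: vwstep_enc_words wstep_def)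
  next
    fix x B :: val and i
    assume "\<exists>b. B = enc_words b \<and> (b = 1 \<or> 4 ^ b \<le> vlen x)"
    then obtain b where B: "B = enc_words b" and b: "b = 1 \<or> 4 ^ b \<le> vlen x" by blast
    show "size B \<le> 8 + size x * Suc (size x * 3)"
    proof (cases "b = 1")
      case True
      then show ?thesis using size_enc_words[of 1] B by simp
    next
      case False
      with b have 4: "4 ^ b \<le> size x" using vlen_le_size le_trans by blast
      then have "2 ^ b \<le> size x" "b \<le> size x"
        using power_mono[of 2 "4::nat" b] less_4_power[of b] by linarith+
      then have "2 ^ b * Suc (b * 3) \<le> size x * Suc (size x * 3)"
        by (intro mult_mono) auto
      then show ?thesis using size_enc_words[of b] B by simp
    qed
  qed (auto intro!: ptime_intros npoly_intros)
qed

text \<open>After \<open>i\<close> steps the length either can grow no more or is at least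
  \<open>i\<close>. For \<open>i = N\<close> the second case also gives
  \<open>N < 4 ^ Suc (wlen N)\<close>, because \<open>b < 4 ^ b\<close>.\<close>

lemma wlen_ge_1: "wlen N \<ge> 1"
  and wlen_upper: "wlen N = 1 \<or> 4 ^ wlen N \<le> N"
  and wlen_lower: "N < 4 ^ Suc (wlen N)"
proof -
  have "(wstep N ^^ i) 1 \<ge> 1 \<and> ((wstep N ^^ i) 1 = 1 \<or> 4 ^ (wstep N ^^ i) 1 \<le> N) \<and>
     (N < 4 ^ Suc ((wstep N ^^ i) 1) \<or> (wstep N ^^ i) 1 \<ge> i)" for i
    by (induction i) (auto simp: wstep_def)
  from this[of N] show "wlen N \<ge> 1" "wlen N = 1 \<or> 4 ^ wlen N \<le> N" "N < 4 ^ Suc (wlen N)"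
    unfolding wlen_def[symmetric]
    using less_4_power[of "wlen N"] by auto
qed

section \<open>The reduction\<close>

text \<open>The number \<open>j * b\<close> of variables before group \<open>j\<close> in unary; the
  word length \<open>b\<close> is read off the first word in \<open>B\<close>.\<close>

definition vprefix :: "val \<Rightarrow> val \<Rightarrow> val" where
  "vprefix B j = vbind (\<lambda>_. vblank (hd_val B)) j"

definition vgroups :: "val \<Rightarrow> val \<Rightarrow> val" where
  "vgroups N B = vbind (\<lambda>j. if vsub N (vprefix B j) = Nl then Nl else Pr j Nl) (vupt N)"

text \<open>A slot is a pair of a group and a user, that is, a possible assignment to the variables
  of the group.\<close>

definition vslots :: "val \<Rightarrow> val \<Rightarrow> val \<Rightarrow> val" where
  "vslots B J U = vmap (\<lambda>p. Pr (hd_val p) (Pr (tl_val p)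
     (vappend (vprefix B (hd_val p)) (hd_val (vsub B (tl_val p)))))) (vprod J U)"

text \<open>\<open>e\<close> is a wrapped bit or a blank and \<open>c\<close> the sign of a literal.
  The result differs from \<open>Nl\<close> iff \<open>e\<close> holds a bit other than
  \<open>c\<close>; a blank falsifies nothing.\<close>

definition vmismatch :: "val \<Rightarrow> val \<Rightarrow> val" where
  "vmismatch e c = (if e = Nl then Nl else if c = Nl then tl_val e
     else if tl_val e = Nl then Pr Nl Nl else Nl)"

definition vfalsifies :: "val \<Rightarrow> val \<Rightarrow> val" where
  "vfalsifies p l = vmismatch (hd_val (vsub (tl_val (tl_val p)) (tl_val l))) (hd_val l)"

text \<open>\<open>vbind\<close> acts as an existential quantifier: the result differs from
  \<open>Nl\<close> iff the three slots, in order, falsify the three literals of some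
  clause.\<close>

definition vclash :: "val \<Rightarrow> val \<Rightarrow> val" where
  "vclash cls q = vbind (\<lambda>c.
     if vfalsifies (hd_val q) (hd_val c) = Nl then Nl
     else if vfalsifies (hd_val (tl_val q)) (hd_val (tl_val c)) = Nl then Nl
     else vfalsifies (tl_val (tl_val q)) (hd_val (tl_val (tl_val c)))) cls"

text \<open>Three copies of the \<open>n\<close> anchors are numbered first, then three copies of
  the \<open>k\<close> group tasks. Concatenation adds the offsets in unary.\<close>

definition vscope6 :: "val \<Rightarrow> val \<Rightarrow> val \<Rightarrow> val" where
  "vscope6 n k q =
     Pr (hd_val (tl_val (hd_val q)))
    (Pr (vappend n (hd_val (tl_val (hd_val (tl_val q)))))
    (Pr (vappend n (vappend n (hd_val (tl_val (tl_val (tl_val q))))))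
    (Pr (vappend n (vappend n (vappend n (hd_val (hd_val q)))))
    (Pr (vappend n (vappend n (vappend n (vappend k (hd_val (hd_val (tl_val q)))))))
    (Pr (vappend n (vappend n (vappend n (vappend k (vappend k (hd_val (tl_val (tl_val q))))))))
    Nl)))))"

definition vscope3 :: "val \<Rightarrow> val \<Rightarrow> val \<Rightarrow> val" where
  "vscope3 n k j =
     Pr (vappend n (vappend n (vappend n j)))
    (Pr (vappend n (vappend n (vappend n (vappend k j))))
    (Pr (vappend n (vappend n (vappend n (vappend k (vappend k j))))) Nl))"

text \<open>An equality test: both truncated differences of two unary numbers vanish iff the numbers
  are equal.\<close>

definition vdiff :: "val \<Rightarrow> val \<Rightarrow> val" where
  "vdiff a b = vappend (vsub a b) (vsub b a)"

definition vvecs6 :: "val \<Rightarrow> val" where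
  "vvecs6 U = vbind (\<lambda>v.
     if vappend (vdiff (hd_val v) (hd_val (tl_val (tl_val (tl_val v)))))
       (vappend (vdiff (hd_val (tl_val v)) (hd_val (tl_val (tl_val (tl_val (tl_val v))))))
          (vdiff (hd_val (tl_val (tl_val v))) (hd_val (tl_val (tl_val (tl_val (tl_val (tl_val v)))))))) = Nl
     then Nl else Pr v Nl)
     (vprod U (vprod U (vprod U (vprod U (vprod U (vprod U (Pr Nl Nl)))))))"

definition vcons6 :: "val \<Rightarrow> val \<Rightarrow> val \<Rightarrow> val \<Rightarrow> val" where
  "vcons6 cls B J U = vbind (\<lambda>q. if vclash cls q = Nl then Nl
      else Pr (Pr (vscope6 (vblank U) (vblank J) q) (vvecs6 U)) Nl)
     (vprod (vslots B J U) (vprod (vslots B J U) (vslots B J U)))"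

definition vcons3 :: "val \<Rightarrow> val \<Rightarrow> val" where
  "vcons3 J U = vmap (\<lambda>j. Pr (vscope3 (vblank U) (vblank J) j)
     (vmap (\<lambda>u. Pr u (Pr u (Pr u Nl))) U)) J"

definition vauth :: "val \<Rightarrow> val \<Rightarrow> val" where
  "vauth J U = vappend (vmap (\<lambda>u. Pr u Nl) (vappend U (vappend U U)))
     (vmap (\<lambda>_. U) (vappend J (vappend J J)))"

definition vwsp :: "val \<Rightarrow> val \<Rightarrow> val \<Rightarrow> val \<Rightarrow> val" where
  "vwsp cls B J U = Pr (vblank (vauth J U)) (Pr (vblank U) (Pr (vauth J U)
     (Pr (vappend (vcons6 cls B J U) (vcons3 J U)) Nl)))"

definition reduction :: "val \<Rightarrow> val" where
  "reduction x = vwsp (tl_val x) (vwords (hd_val x)) (vgroups (hd_val x) (vwords (hd_val x)))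
     (vupt (vblank (vwords (hd_val x))))"

section \<open>Polynomial time of the reduction\<close>

lemma ptime_vprefix [ptime_intros]:
  assumes "ptime f" "ptime g"
  shows "ptime (\<lambda>x. vprefix (f x) (g x))"
  unfolding vprefix_def by (intro ptime_intros assms assms[THEN ptime_comp])

lemma ptime_vgroups [ptime_intros]:
  assumes "ptime f" "ptime g"
  shows "ptime (\<lambda>x. vgroups (f x) (g x))"
  unfolding vgroups_def by (intro ptime_intros assms assms[THEN ptime_comp])

lemma ptime_vslots [ptime_intros]:
  assumes "ptime f" "ptime g" "ptime h"
  shows "ptime (\<lambda>x. vslots (f x) (g x) (h x))"
  unfolding vslots_def by (intro ptime_intros assms assms[THEN ptime_comp])

lemma ptime_vfalsifies [ptime_intros]:
  assumes "ptime f" "ptime g"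
  shows "ptime (\<lambda>x. vfalsifies (f x) (g x))"
  unfolding vfalsifies_def vmismatch_def by (intro ptime_intros assms)

lemma ptime_vclash [ptime_intros]:
  assumes "ptime f" "ptime g"
  shows "ptime (\<lambda>x. vclash (f x) (g x))"
  unfolding vclash_def by (intro ptime_intros assms assms[THEN ptime_comp])

lemma ptime_vscope6 [ptime_intros]:
  assumes "ptime f" "ptime g" "ptime h"
  shows "ptime (\<lambda>x. vscope6 (f x) (g x) (h x))"
  unfolding vscope6_def by (intro ptime_intros assms)

lemma ptime_vscope3 [ptime_intros]:
  assumes "ptime f" "ptime g" "ptime h"
  shows "ptime (\<lambda>x. vscope3 (f x) (g x) (h x))"
  unfolding vscope3_def by (intro ptime_intros assms)

lemma ptime_vvecs6 [ptime_intros]: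
  assumes "ptime f"
  shows "ptime (\<lambda>x. vvecs6 (f x))"
  unfolding vvecs6_def vdiff_def by (intro ptime_intros assms assms[THEN ptime_comp])

lemma ptime_vcons6 [ptime_intros]:
  assumes "ptime f" "ptime g" "ptime h" "ptime i"
  shows "ptime (\<lambda>x. vcons6 (f x) (g x) (h x) (i x))"
  unfolding vcons6_def by (intro ptime_intros assms assms[THEN ptime_comp])

lemma ptime_vcons3 [ptime_intros]:
  assumes "ptime f" "ptime g"
  shows "ptime (\<lambda>x. vcons3 (f x) (g x))"
  unfolding vcons3_def by (intro ptime_intros assms assms[THEN ptime_comp])

lemma ptime_vauth [ptime_intros]:
  assumes "ptime f" "ptime g"
  shows "ptime (\<lambda>x. vauth (f x) (g x))"
  unfolding vauth_def by (intro ptime_intros assms assms[THEN ptime_comp])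

lemma ptime_reduction: "ptime reduction"
  unfolding reduction_def vwsp_def by (intro ptime_intros)

section \<open>The target instance in terms of lists of numbers\<close>

definition num_groups :: "nat \<Rightarrow> nat" where
  "num_groups N = (N + wlen N - 1) div wlen N"

text \<open>Variable \<open>v\<close> is number \<open>v mod b\<close> of group
  \<open>v div b\<close>. A slot falsifies no literal outside its group.\<close>

definition falsifies :: "nat \<Rightarrow> nat \<times> nat \<Rightarrow> literal \<Rightarrow> bool" where
  "falsifies b p l \<longleftrightarrow> snd l div b = fst p \<and> words b ! snd p ! (snd l mod b) \<noteq> fst l"

type_synonym slots = "(nat \<times> nat) \<times> (nat \<times> nat) \<times> (nat \<times> nat)"

fun clash :: "nat \<Rightarrow> clause list \<Rightarrow> slots \<Rightarrow> bool" where
  "clash b cls (p\<^sub>1, p\<^sub>2, p\<^sub>3) \<longleftrightarrow>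
     (\<exists>(l\<^sub>1, l\<^sub>2, l\<^sub>3) \<in> set cls. falsifies b p\<^sub>1 l\<^sub>1 \<and> falsifies b p\<^sub>2 l\<^sub>2 \<and> falsifies b p\<^sub>3 l\<^sub>3)"

text \<open>For slots in range, the entries lie in six consecutive blocks of tasks and increase
  strictly, so the list is determined by its set.\<close>

fun scope6 :: "nat \<Rightarrow> nat \<Rightarrow> slots \<Rightarrow> nat list" where
  "scope6 n k ((j\<^sub>1, i\<^sub>1), (j\<^sub>2, i\<^sub>2), (j\<^sub>3, i\<^sub>3)) =
     [i\<^sub>1, n + i\<^sub>2, 2 * n + i\<^sub>3, 3 * n + j\<^sub>1, 3 * n + k + j\<^sub>2, 3 * n + 2 * k + j\<^sub>3]"

definition scope3 :: "nat \<Rightarrow> nat \<Rightarrow> nat \<Rightarrow> nat list" where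
  "scope3 n k j = [3 * n + j, 3 * n + k + j, 3 * n + 2 * k + j]"

text \<open>Positions 0 to 2 belong to anchors, 3 to 5 to group tasks. Which assignments are
  forbidden is expressed by the choice of tasks in the scope, so the same vectors serve all
  clauses.\<close>

definition vecs6 :: "nat \<Rightarrow> nat list list" where
  "vecs6 n = filter (\<lambda>v. \<not> (v ! 0 = v ! 3 \<and> v ! 1 = v ! 4 \<and> v ! 2 = v ! 5))
     (product_lists (replicate 6 [0..<n]))"

definition vecs3 :: "nat \<Rightarrow> nat list list" where
  "vecs3 n = map (\<lambda>u. [u, u, u]) [0..<n]"

text \<open>The constraints are listed by enumerating slots rather than clauses, so that repeated clauses
  do not produce repeated constraints.\<close>

definition slot_triples :: "nat \<Rightarrow> nat \<Rightarrow> slots list" where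
  "slot_triples n k = (let S = List.product [0..<k] [0..<n] in List.product S (List.product S S))"

definition auth_lists :: "nat \<Rightarrow> nat \<Rightarrow> nat list list" where
  "auth_lists n k = map (\<lambda>u. [u]) ([0..<n] @ [0..<n] @ [0..<n]) @
     map (\<lambda>_. [0..<n]) ([0..<k] @ [0..<k] @ [0..<k])"

definition cons_lists :: "nat \<Rightarrow> nat \<Rightarrow> clause list \<Rightarrow> (nat list \<times> nat list list) list" where
  "cons_lists b k cls =
     map (\<lambda>q. (scope6 (2 ^ b) k q, vecs6 (2 ^ b))) (filter (clash b cls) (slot_triples (2 ^ b) k)) @
     map (\<lambda>j. (scope3 (2 ^ b) k j, vecs3 (2 ^ b))) [0..<k]"

fun enc_cons :: "nat list \<times> nat list list \<Rightarrow> val" where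
  "enc_cons (ls, ts) = Pr (enc_list enc_nat ls) (enc_list (enc_list enc_nat) ts)"

section \<open>The tree functions compute the target instance\<close>

lemma words_nonempty: "words b \<noteq> []"
  using length_words[of b] by auto

lemma vprefix_enc: "vprefix (enc_words b) (enc_nat j) = enc_nat (j * b)"
proof -
  have "length (hd (words b)) = b" using hd_in_set[OF words_nonempty[of b]] by (simp add: set_words)
  then have "vblank (hd_val (enc_words b)) = enc_nat b" using words_nonempty[of b]
    by (cases "words b") (simp_all add: enc_words_def vblank_enc_list set_words)
  then show ?thesis
    unfolding vprefix_def by (induction j) (auto simp: enc_nat_0 enc_nat_Suc vappend_enc_nat)
qed

lemma less_num_groups: "j < num_groups N \<longleftrightarrow> j * wlen N < N"
proof -
  have "Suc j \<le> num_groups N \<longleftrightarrow> Suc j * wlen N \<le> N + wlen N - 1"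
    unfolding num_groups_def using wlen_ge_1[of N] by (intro less_eq_div_iff_mult_less_eq) simp
  then show ?thesis using wlen_ge_1[of N] by (auto simp: Suc_le_eq)
qed

text \<open>Since \<open>wlen N \<ge> 1\<close>, there are at most \<open>N\<close> groups, and
  searching the numbers below \<open>N\<close> finds them all.\<close>

lemma vgroups_enc:
  "vgroups (enc_nat N) (enc_words (wlen N)) = enc_list enc_nat [0..<num_groups N]"
proof -
  have "vgroups (enc_nat N) (enc_words (wlen N)) =
      enc_list enc_nat (filter (\<lambda>j. j * wlen N < N) [0..<N])"
    unfolding vgroups_def vupt_eq vlen_enc_nat
    by (rule vbind_filter_enc_list) (simp add: vprefix_enc vsub_enc_nat vlen_enc_nat enc_nat_eq_Nl_iff)
  also have "filter (\<lambda>j. j * wlen N < N) [0..<N] = filter (\<lambda>j. j < num_groups N) [0..<N]"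
    by (simp add: less_num_groups)
  also have "\<dots> = [0..<num_groups N]"
  proof -
    have "num_groups N \<le> N"
      using less_num_groups[of N N] wlen_ge_1[of N] by (cases "wlen N") auto
    then have "[0..<N] = [0..<num_groups N] @ [num_groups N..<N]"
      using upt_add_eq_append[of 0 "num_groups N" "N - num_groups N"] by simp
    then show ?thesis by simp
  qed
  finally show ?thesis .
qed

text \<open>The third component lists a partial assignment of all variables: blanks for the variables
  before group \<open>j\<close>, then the values that word number \<open>i\<close> gives to the variables of group \<open>j\<close>. The
  value assigned to a variable is thus found by position, and a missing entry reads as a blank because
  the head of \<^const>\<open>Nl\<close> is \<^const>\<open>Nl\<close>.\<close>

definition enc_slot :: "nat \<Rightarrow> nat \<times> nat \<Rightarrow> val" where
  "enc_slot b p = Pr (enc_nat (fst p)) (Pr (enc_nat (snd p))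
     (vappend (enc_nat (fst p * b)) (enc_list (\<lambda>c. Pr Nl (enc_bool c)) (words b ! snd p))))"

lemma vslots_enc:
  assumes "n \<le> 2 ^ b"
  shows "vslots (enc_words b) (enc_list enc_nat [0..<k]) (enc_list enc_nat [0..<n]) =
     enc_list (enc_slot b) (List.product [0..<k] [0..<n])"
proof -
  have nth: "hd_val (vsub (enc_words b) (enc_nat i)) = enc_list (\<lambda>c. Pr Nl (enc_bool c)) (words b ! i)"
    if "i < n" for i
    using that assms length_words[of b]
    by (simp add: enc_words_def vsub_enc_list vlen_enc_nat Cons_nth_drop_Suc[symmetric])
  show ?thesis
    unfolding vslots_def vprod_enc_list
    by (subst vmap_enc_list[where G = "\<lambda>x. x" and g = "enc_slot b"])
      (auto simp: vprefix_enc nth enc_slot_def)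
qed

text \<open>The assignment of the slot is viewed as a list of optional bits. The variable lies
  before the group, inside it or beyond the end of the list; in the outer cases a blank is
  read.\<close>

lemma vfalsifies_enc:
  assumes b: "b > 0" and i: "i < 2 ^ b"
  shows "vfalsifies (enc_slot b (j, i)) (enc_literal l) \<noteq> Nl \<longleftrightarrow> falsifies b (j, i) l"
proof -
  obtain c v where l: "l = (c, v)" by (cases l)
  let ?w = "words b ! i"
  have w: "length ?w = b" using nth_mem[of i "words b"] i by (simp add: length_words set_words)
  let ?e = "\<lambda>c. Pr Nl (enc_bool c)"
  let ?f = "case_option Nl ?e"
  let ?s = "replicate (j * b) None @ map Some ?w"
  have "vappend (enc_nat a) (enc_list ?e ?w) = enc_list ?f (replicate a None @ map Some ?w)" for a
    by (induction a) (simp_all add: enc_nat_0 enc_nat_Suc enc_list_map)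
  then have "hd_val (vsub (tl_val (tl_val (enc_slot b (j, i)))) (tl_val (enc_literal l))) =
     hd_val (enc_list ?f (drop v ?s))"
    unfolding enc_slot_def l by (simp add: vsub_enc_list vlen_enc_nat)
  also have "\<dots> = (if v div b = j then ?e (?w ! (v mod b)) else Nl)"
  proof (cases "v < length ?s")
    case True
    then have "hd_val (enc_list ?f (drop v ?s)) = ?f (?s ! v)"
      by (simp only: Cons_nth_drop_Suc[symmetric] enc_list.simps hd_val.simps)
    moreover have "?s ! v = (if v div b = j then Some (?w ! (v mod b)) else None)"
    proof (cases "v < j * b")
      case True
      then have "v div b < j" using b by (simp add: div_less_iff_less_mult)
      then show ?thesis using True by (simp add: nth_append)
    next
      case False
      with True w have "v div b = j"
        by (intro div_nat_eqI) (auto simp: algebra_simps)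
      moreover from this have "v mod b = v - j * b"
        by (metis minus_div_mult_eq_mod)
      ultimately show ?thesis using False True w by (simp add: nth_append)
    qed
    ultimately show ?thesis by simp
  next
    case False
    then have "v div b > j" using b w
      by (simp add: less_eq_div_iff_mult_less_eq flip: Suc_le_eq)
    then show ?thesis using False by simp
  qed
  finally show ?thesis
    by (simp add: vfalsifies_def l vmismatch_def falsifies_def enc_bool_def)
qed

lemma vbind_eq_Nl_iff: "vbind F (enc_list f xs) = Nl \<longleftrightarrow> (\<forall>x \<in> set xs. F (f x) = Nl)"
proof -
  have "vappend a b = Nl \<longleftrightarrow> a = Nl \<and> b = Nl" for a b by (cases a) auto
  then show ?thesis by (induction xs) auto
qed

lemma vclash_enc:
  assumes "b > 0" "snd p\<^sub>1 < 2 ^ b" "snd p\<^sub>2 < 2 ^ b" "snd p\<^sub>3 < 2 ^ b"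
  shows "vclash (enc_list enc_clause cls) (Pr (enc_slot b p\<^sub>1) (Pr (enc_slot b p\<^sub>2) (enc_slot b p\<^sub>3))) \<noteq> Nl
    \<longleftrightarrow> clash b cls (p\<^sub>1, p\<^sub>2, p\<^sub>3)"
proof -
  have F: "vfalsifies (enc_slot b p) (enc_literal l) = Nl \<longleftrightarrow> \<not> falsifies b p l" if "snd p < 2 ^ b" for p l
    using vfalsifies_enc[OF assms(1) that, of "fst p" l] by auto
  show ?thesis
    unfolding vclash_def vbind_eq_Nl_iff clash.simps ball_simps(10)
    by (rule bex_cong) (auto simp: F assms simp del: enc_literal.simps split: if_splits)
qed

lemma vscope6_enc:
  "vscope6 (enc_nat n) (enc_nat k) (Pr (enc_slot b p\<^sub>1) (Pr (enc_slot b p\<^sub>2) (enc_slot b p\<^sub>3))) =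
     enc_list enc_nat (scope6 n k (p\<^sub>1, p\<^sub>2, p\<^sub>3))"
  by (cases p\<^sub>1; cases p\<^sub>2; cases p\<^sub>3)
    (auto simp: vscope6_def enc_slot_def vappend_enc_nat intro!: arg_cong[of _ _ enc_nat])

lemma vscope3_enc: "vscope3 (enc_nat n) (enc_nat k) (enc_nat j) = enc_list enc_nat (scope3 n k j)"
  by (auto simp: vscope3_def scope3_def vappend_enc_nat intro!: arg_cong[of _ _ enc_nat])

lemma vvecs6_enc: "vvecs6 (enc_list enc_nat [0..<n]) = enc_list (enc_list enc_nat) (vecs6 n)"
proof -
  let ?U = "enc_list enc_nat [0..<n]" and ?e = "enc_list enc_nat"
  have "Pr Nl Nl = enc_list ?e [[]]" by simp
  moreover have "replicate 6 [0..<n] = [[0..<n], [0..<n], [0..<n], [0..<n], [0..<n], [0..<n]]"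
    by (simp add: numeral_eq_Suc)
  ultimately have prod: "vprod ?U (vprod ?U (vprod ?U (vprod ?U (vprod ?U (vprod ?U (Pr Nl Nl)))))) =
      enc_list ?e (product_lists (replicate 6 [0..<n]))"
    by (simp only: vprod_enc_list_Cons product_lists.simps)
  show ?thesis
    unfolding vvecs6_def vecs6_def prod
  proof (rule vbind_filter_enc_list)
    fix v assume "v \<in> set (product_lists (replicate 6 [0..<n]))"
    then have "length v = 6" by (auto simp: product_lists_set dest: list_all2_lengthD)
    then obtain a b c d e f where "v = [a, b, c, d, e, f]"
      by (auto simp: length_Suc_conv numeral_eq_Suc)
    then show "(if vappend (vdiff (hd_val (?e v)) (hd_val (tl_val (tl_val (tl_val (?e v))))))
       (vappend (vdiff (hd_val (tl_val (?e v))) (hd_val (tl_val (tl_val (tl_val (tl_val (?e v)))))))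
          (vdiff (hd_val (tl_val (tl_val (?e v)))) (hd_val (tl_val (tl_val (tl_val (tl_val (tl_val (?e v))))))))) = Nl
     then Nl else Pr (?e v) Nl) =
      (if \<not> (v ! 0 = v ! 3 \<and> v ! 1 = v ! 4 \<and> v ! 2 = v ! 5) then Pr (?e v) Nl else Nl)"
      by (auto simp: vdiff_def vsub_enc_nat vlen_enc_nat vappend_enc_nat enc_nat_eq_Nl_iff)
  qed
qed

lemma vcons6_enc:
  assumes "b > 0"
  shows "vcons6 (enc_list enc_clause cls) (enc_words b) (enc_list enc_nat [0..<k])
      (enc_list enc_nat [0..<2 ^ b]) =
    enc_list enc_cons (map (\<lambda>q. (scope6 (2 ^ b) k q, vecs6 (2 ^ b)))
      (filter (clash b cls) (slot_triples (2 ^ b) k)))"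
  unfolding vcons6_def vslots_enc[OF order_refl] vprod_enc_list slot_triples_def Let_def enc_list_map
    vblank_enc_list vvecs6_enc
proof (rule vbind_filter_enc_list, goal_cases)
  case (1 q)
  obtain p\<^sub>1 p\<^sub>2 p\<^sub>3 where q: "q = (p\<^sub>1, p\<^sub>2, p\<^sub>3)" by (cases q)
  with 1 have "snd p\<^sub>1 < 2 ^ b" "snd p\<^sub>2 < 2 ^ b" "snd p\<^sub>3 < 2 ^ b" by auto
  from vclash_enc[OF assms this] show ?case
    by (auto simp: q vscope6_enc)
qed

lemma vcons3_enc:
  "vcons3 (enc_list enc_nat [0..<k]) (enc_list enc_nat [0..<n]) =
     enc_list enc_cons (map (\<lambda>j. (scope3 n k j, vecs3 n)) [0..<k])"
proof -
  have "vmap (\<lambda>u. Pr u (Pr u (Pr u Nl))) (enc_list enc_nat [0..<n]) =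
      enc_list (enc_list enc_nat) (vecs3 n)"
    unfolding vecs3_def by (rule vmap_enc_list) simp
  then show ?thesis
    unfolding vcons3_def vblank_enc_list by (intro vmap_enc_list) (simp add: vscope3_enc)
qed

lemma vauth_enc:
  "vauth (enc_list enc_nat [0..<k]) (enc_list enc_nat [0..<n]) =
     enc_list (enc_list enc_nat) (auth_lists n k)"
proof -
  have "vmap (\<lambda>u. Pr u Nl) (enc_list enc_nat xs) = enc_list (enc_list enc_nat) (map (\<lambda>u. [u]) xs)" for xs
    by (rule vmap_enc_list) simp
  moreover have "vmap (\<lambda>_. enc_list enc_nat [0..<n]) (enc_list enc_nat xs) =
      enc_list (enc_list enc_nat) (map (\<lambda>_. [0..<n]) xs)" for xs
    by (rule vmap_enc_list) simp
  ultimately show ?thesis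
    unfolding vauth_def auth_lists_def by (simp only: vappend_enc_list)
qed

lemma reduction_enc:
  fixes N :: nat
  defines "b \<equiv> wlen N" and "k \<equiv> num_groups N"
  shows "reduction (enc_formula (N, cls)) = enc_list (\<lambda>v. v)
    [enc_nat (3 * 2 ^ b + 3 * k), enc_nat (2 ^ b), enc_list (enc_list enc_nat) (auth_lists (2 ^ b) k),
     enc_list (\<lambda>v. v) (map enc_cons (cons_lists b k cls))]"
proof -
  have B: "vwords (enc_nat N) = enc_words b"
    by (simp add: vwords_eq vlen_enc_nat b_def)
  have U: "vupt (vblank (enc_words b)) = enc_list enc_nat [0..<2 ^ b]"
    by (simp add: enc_words_def vblank_enc_list vupt_eq vlen_enc_nat length_words)
  have J: "vgroups (enc_nat N) (enc_words b) = enc_list enc_nat [0..<k]"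
    unfolding b_def k_def by (rule vgroups_enc)
  have b: "b > 0" using wlen_ge_1[of N] unfolding b_def by simp
  have len: "length (auth_lists (2 ^ b) k) = 3 * 2 ^ b + 3 * k"
    by (simp add: auth_lists_def)
  show ?thesis
    unfolding reduction_def enc_formula_def fst_conv snd_conv hd_val.simps tl_val.simps B U J vwsp_def
      vauth_enc vblank_enc_list len vcons6_enc[OF b] vcons3_enc vappend_enc_list
    by (simp only: enc_list_map cons_lists_def enc_list.simps length_upt diff_zero)
qed

section \<open>Correctness of the reduction\<close>

fun wsp_cons :: "nat \<Rightarrow> nat list \<times> nat list list \<Rightarrow> (nat, nat) wsp_constraint" where
  "wsp_cons n (ls, ts) = (set ls, {\<theta> \<in> set ls \<rightarrow>\<^sub>E {..<n}. map \<theta> ls \<in> set ts})"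

definition ntasks :: "nat \<Rightarrow> nat" where
  "ntasks N = 3 * 2 ^ wlen N + 3 * num_groups N"

definition wsp_of :: "nat \<Rightarrow> clause list \<Rightarrow> (nat, nat) wsp" where
  "wsp_of N cls = \<lparr>tasks = {..<ntasks N}, users = {..<2 ^ wlen N},
     auth = (\<lambda>s. if s < 3 * 2 ^ wlen N then {s mod 2 ^ wlen N} else {..<2 ^ wlen N}),
     constraints = wsp_cons (2 ^ wlen N) ` set (cons_lists (wlen N) (num_groups N) cls)\<rparr>"

text \<open>Sortedness lets the set of a scope determine its list, distinct vectors give a listing
  without repetitions, and closure under permutations gives user-independence.\<close>

fun ui_cons_lists :: "nat \<Rightarrow> nat \<Rightarrow> nat list \<times> nat list list \<Rightarrow> bool" where
  "ui_cons_lists n K (ls, ts) \<longleftrightarrow> sorted_wrt (<) ls \<and> set ls \<subseteq> {..<K} \<and> distinct ts \<and>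
     (\<forall>t \<in> set ts. length t = length ls \<and> set t \<subseteq> {..<n} \<and>
       (\<forall>\<psi>. \<psi> permutes {..<n} \<longrightarrow> map \<psi> t \<in> set ts))"

lemma set_vecs6:
  "set (vecs6 n) = {v. length v = 6 \<and> set v \<subseteq> {..<n} \<and> \<not> (v ! 0 = v ! 3 \<and> v ! 1 = v ! 4 \<and> v ! 2 = v ! 5)}"
proof -
  have "list_all2 (\<lambda>x ys. x \<in> set ys) v (replicate 6 [0..<n]) \<longleftrightarrow> length v = 6 \<and> set v \<subseteq> {..<n}" for v
    by (auto simp: list_all2_conv_all_nth subset_iff in_set_conv_nth[of _ v])
  then show ?thesis unfolding vecs6_def set_filter product_lists_set by simp
qed

lemma set_vecs3: "set (vecs3 n) = {[u, u, u] | u. u < n}"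
  by (auto simp: vecs3_def)

lemma set_slot_triples:
  "set (slot_triples n k) = {((j\<^sub>1, i\<^sub>1), (j\<^sub>2, i\<^sub>2), (j\<^sub>3, i\<^sub>3)) | j\<^sub>1 i\<^sub>1 j\<^sub>2 i\<^sub>2 j\<^sub>3 i\<^sub>3.
     j\<^sub>1 < k \<and> i\<^sub>1 < n \<and> j\<^sub>2 < k \<and> i\<^sub>2 < n \<and> j\<^sub>3 < k \<and> i\<^sub>3 < n}"
  by (auto simp: slot_triples_def Let_def)

text \<open>Among vectors over the users, membership in \<open>vecs6 n\<close> depends only on which
  entries agree, and permutations preserve this by injectivity.\<close>

lemma ui_cons_lists_vecs6:
  assumes "q \<in> set (slot_triples n k)"
  shows "ui_cons_lists n (3 * n + 3 * k) (scope6 n k q, vecs6 n)"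
proof -
  have "map \<psi> v \<in> set (vecs6 n)" if "\<psi> permutes {..<n}" "v \<in> set (vecs6 n)" for \<psi> v
    using that permutes_inj[OF that(1)] permutes_in_image[OF that(1)]
    unfolding set_vecs6 by (auto simp: inj_eq)
  moreover have "distinct (vecs6 n)"
    by (auto simp: vecs6_def intro!: distinct_filter distinct_product_lists)
  moreover have "length v = 6 \<and> set v \<subseteq> {..<n}" if "v \<in> set (vecs6 n)" for v
    using that by (simp add: set_vecs6)
  ultimately show ?thesis
    using assms by (auto simp: set_slot_triples)
qed

lemma ui_cons_lists_vecs3:
  assumes "j < k"
  shows "ui_cons_lists n (3 * n + 3 * k) (scope3 n k j, vecs3 n)"
proof -
  have "map \<psi> v \<in> set (vecs3 n)" if "\<psi> permutes {..<n}" "v \<in> set (vecs3 n)" for \<psi> v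
    using that permutes_in_image[OF that(1)] unfolding set_vecs3 by auto
  moreover have "distinct (vecs3 n)"
    by (auto simp: vecs3_def distinct_map inj_on_def)
  moreover have "length v = 3 \<and> set v \<subseteq> {..<n}" if "v \<in> set (vecs3 n)" for v
    using that by (auto simp: set_vecs3)
  ultimately show ?thesis
    using assms by (auto simp: scope3_def)
qed

lemma ui_cons_lists_cons_lists:
  "c \<in> set (cons_lists b k cls) \<Longrightarrow> ui_cons_lists (2 ^ b) (3 * 2 ^ b + 3 * k) c"
  unfolding cons_lists_def using ui_cons_lists_vecs6 ui_cons_lists_vecs3 by auto

text \<open>The scope has no repetitions, so pairing it with a listed vector defines a function that
  has this value vector.\<close>

lemma encodes_wsp_cons:
  assumes "ui_cons_lists n K c"
  shows "encodes_constraint (wsp_cons n c) (enc_cons c)"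
proof -
  obtain ls ts where c: "c = (ls, ts)" by (cases c)
  have ls: "distinct ls" using assms by (auto simp: c strict_sorted_iff)
  let ?T = "{\<theta> \<in> set ls \<rightarrow>\<^sub>E {..<n}. map \<theta> ls \<in> set ts}"
  have "t \<in> (\<lambda>\<theta>. map \<theta> ls) ` ?T" if t: "t \<in> set ts" for t
  proof -
    have len: "length ls = length t" and sub: "set t \<subseteq> {..<n}" using assms t by (auto simp: c)
    let ?\<theta> = "restrict (\<lambda>x. the (map_of (zip ls t) x)) (set ls)"
    have eq: "map ?\<theta> ls = t"
      using map_of_zip_nth[OF len ls] len by (auto intro!: nth_equalityI)
    then have "?\<theta> ` set ls = set t" by (metis image_set)
    then have "?\<theta> x \<in> {..<n}" if "x \<in> set ls" for x using sub that by blast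
    then have "?\<theta> \<in> set ls \<rightarrow>\<^sub>E {..<n}" by (intro PiE_I) auto
    then have "?\<theta> \<in> ?T" unfolding mem_Collect_eq eq using t by blast
    then have "map ?\<theta> ls \<in> (\<lambda>\<theta>. map \<theta> ls) ` ?T" by (rule imageI)
    then show ?thesis unfolding eq .
  qed
  then have "set ts = (\<lambda>\<theta>. map \<theta> ls) ` ?T" by auto
  then show ?thesis
    using assms ls unfolding c by (auto simp: lists_set_def)
qed

lemma user_independent_wsp_cons:
  assumes "ui_cons_lists n K c" "users W = {..<n}"
  shows "user_independent W (wsp_cons n c)"
proof -
  obtain ls ts where c: "c = (ls, ts)" by (cases c)
  show ?thesis
    unfolding user_independent_def
  proof (intro ballI allI impI)
    fix \<theta> \<psi> assume \<theta>: "\<theta> \<in> snd (wsp_cons n c)" and \<psi>: "\<psi> permutes users W"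
    have eq: "map (compose (set ls) \<psi> \<theta>) ls = map \<psi> (map \<theta> ls)"
      by (simp add: compose_def)
    have "map \<psi> (map \<theta> ls) \<in> set ts"
      using \<theta> \<psi> assms by (auto simp: c)
    moreover have "compose (set ls) \<psi> \<theta> \<in> set ls \<rightarrow>\<^sub>E {..<n}"
      using \<theta> permutes_in_image[OF \<psi>] assms(2) by (auto simp: c compose_def)
    ultimately show "compose (fst (wsp_cons n c)) \<psi> \<theta> \<in> snd (wsp_cons n c)"
      unfolding c wsp_cons.simps fst_conv snd_conv mem_Collect_eq eq by blast
  qed
qed

text \<open>Already the scopes differ: \<open>scope6\<close> and \<open>scope3\<close> are injective
  with values of different lengths, and strictly sorted lists are determined by their sets.\<close>

lemma distinct_wsp_cons: "distinct (map (wsp_cons (2 ^ b)) (cons_lists b k cls))"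
proof -
  let ?n = "2 ^ b" and ?L = "cons_lists b k cls"
  have inj6: "inj (scope6 ?n k)"
  proof (rule injI)
    fix q q' assume "scope6 ?n k q = scope6 ?n k q'"
    then show "q = q'" by (cases q; cases q'; auto)
  qed
  have inj3: "inj (scope3 ?n k)" by (auto simp: inj_def scope3_def)
  have slots: "distinct (slot_triples ?n k)"
    by (auto simp: slot_triples_def Let_def intro!: distinct_product)
  have "length (scope6 ?n k q) \<noteq> length (scope3 ?n k j)" for q j
    by (cases q) (auto simp: scope3_def)
  then have "scope6 ?n k q \<noteq> scope3 ?n k j" for q j
    by metis
  then have "distinct (map fst ?L)"
    using slots by (auto simp: cons_lists_def comp_def distinct_map
        intro: inj_on_subset[OF inj6] inj_on_subset[OF inj3])
  moreover have "inj_on set (set (map fst ?L))"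
  proof (rule inj_onI)
    fix l l' assume "l \<in> set (map fst ?L)" "l' \<in> set (map fst ?L)" and eq: "set l = set l'"
    then have "sorted_wrt (<) l" "sorted_wrt (<) l'"
      using ui_cons_lists_cons_lists[of _ b k cls] by (metis (no_types) image_set imageE surjective_pairing ui_cons_lists.simps)+
    then show "l = l'" using eq by (simp add: strict_sorted_iff sorted_distinct_set_unique)
  qed
  ultimately have "distinct (map set (map fst ?L))"
    unfolding distinct_map[where f = set] by blast
  also have "map set (map fst ?L) = map fst (map (wsp_cons ?n) ?L)" by auto
  finally show ?thesis by (simp only: distinct_map)
qed

lemma auth_lists_enc:
  assumes "s < 3 * n + 3 * k"
  shows "lists_set (auth_lists n k ! s) (if s < 3 * n then {s mod n} else {..<n})"
proof -
  have 1: "auth_lists n k ! s = [0..<n]" if "\<not> s < 3 * n"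
  proof -
    have "auth_lists n k ! s = map (\<lambda>_. [0..<n]) ([0..<k] @ [0..<k] @ [0..<k]) ! (s - (n + (n + n)))"
      using that by (simp add: auth_lists_def nth_append del: map_append)
    also have "\<dots> = [0..<n]"
      using that assms by (subst nth_map) auto
    finally show ?thesis .
  qed
  have 2: "auth_lists n k ! s = [s mod n]" if "s < 3 * n"
  proof -
    have "auth_lists n k ! s = [([0..<n] @ [0..<n] @ [0..<n]) ! s]"
      using that by (simp add: auth_lists_def nth_append del: map_append)
    also have "([0..<n] @ [0..<n] @ [0..<n]) ! s = s mod n"
      using that by (auto simp: nth_append mod_if)
    finally show ?thesis .
  qed
  show ?thesis using 1 2 by (auto simp: lists_set_def)
qed

lemma reduction_wsp_of: "(wsp_of N cls, reduction (enc_formula (N, cls))) \<in> ui_wsp_inputs"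
proof -
  let ?b = "wlen N" and ?k = "num_groups N"
  let ?L = "cons_lists ?b ?k cls"
  have L: "ui_cons_lists (2 ^ ?b) (ntasks N) c" if "c \<in> set ?L" for c
    using ui_cons_lists_cons_lists[OF that] by (simp add: ntasks_def)
  have "set ls \<subseteq> {..<ntasks N}" if "(ls, ts) \<in> set ?L" for ls ts
    using L[OF that] by simp
  then have "wsp_instance (wsp_of N cls)"
    unfolding wsp_instance_def by (auto simp: wsp_of_def) (meson lessThan_iff subsetD)
  moreover have "user_independent (wsp_of N cls) c" if c: "c \<in> constraints (wsp_of N cls)" for c
  proof -
    obtain c' where "c' \<in> set ?L" "c = wsp_cons (2 ^ ?b) c'" using c unfolding wsp_of_def wsp.simps by blast
    then show ?thesis using user_independent_wsp_cons[OF L] by (simp add: wsp_of_def)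
  qed
  moreover have "encodes_wsp (wsp_of N cls) (reduction (enc_formula (N, cls)))"
    unfolding encodes_wsp_def
  proof (intro exI conjI)
    show "tasks (wsp_of N cls) = {..<ntasks N}" "users (wsp_of N cls) = {..<2 ^ ?b}"
      by (simp_all add: wsp_of_def)
    show "length (auth_lists (2 ^ ?b) ?k) = ntasks N"
      by (simp add: auth_lists_def ntasks_def)
    show "\<forall>s<ntasks N. lists_set (auth_lists (2 ^ ?b) ?k ! s) (auth (wsp_of N cls) s)"
      using auth_lists_enc[of _ "2 ^ ?b" ?k] by (simp add: wsp_of_def ntasks_def)
    show "lists_set (map (wsp_cons (2 ^ ?b)) ?L) (constraints (wsp_of N cls))"
      using distinct_wsp_cons by (simp add: lists_set_def wsp_of_def)
    show "list_all2 encodes_constraint (map (wsp_cons (2 ^ ?b)) ?L) (map enc_cons ?L)"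
      unfolding list.rel_map list_all2_same using encodes_wsp_cons[OF L] by blast
    show "reduction (enc_formula (N, cls)) = enc_list (\<lambda>v. v) [enc_nat (ntasks N), enc_nat (2 ^ ?b),
        enc_list (enc_list enc_nat) (auth_lists (2 ^ ?b) ?k), enc_list (\<lambda>v. v) (map enc_cons ?L)]"
      unfolding ntasks_def by (rule reduction_enc)
  qed
  ultimately show ?thesis by (simp add: ui_wsp_inputs_def)
qed

section \<open>Valid complete plans and satisfying assignments\<close>

lemma valid_complete_plan_wsp_of:
  "valid_complete_plan (wsp_of N cls) \<pi> \<longleftrightarrow>
     \<pi> \<in> {..<ntasks N} \<rightarrow>\<^sub>E {..<2 ^ wlen N} \<and> (\<forall>s < 3 * 2 ^ wlen N. \<pi> s = s mod 2 ^ wlen N) \<and>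
     (\<forall>(ls, ts) \<in> set (cons_lists (wlen N) (num_groups N) cls). map \<pi> ls \<in> set ts)"
proof (cases "\<pi> \<in> {..<ntasks N} \<rightarrow>\<^sub>E {..<2 ^ wlen N}")
  case True
  let ?L = "cons_lists (wlen N) (num_groups N) cls"
  have "satisfies {..<ntasks N} \<pi> (wsp_cons (2 ^ wlen N) (ls, ts)) \<longleftrightarrow> map \<pi> ls \<in> set ts"
    if "(ls, ts) \<in> set ?L" for ls ts
  proof -
    have sub: "set ls \<subseteq> {..<ntasks N}"
      using ui_cons_lists_cons_lists[OF that] by (simp add: ntasks_def)
    have eq: "map (restrict \<pi> (set ls)) ls = map \<pi> ls" by simp
    have "restrict \<pi> (set ls) \<in> set ls \<rightarrow>\<^sub>E {..<2 ^ wlen N}"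
      using True sub by auto
    then show ?thesis using sub
      unfolding satisfies_def wsp_cons.simps fst_conv snd_conv mem_Collect_eq eq by blast
  qed
  then have "eligible (wsp_of N cls) {..<ntasks N} \<pi> \<longleftrightarrow> (\<forall>(ls, ts) \<in> set ?L. map \<pi> ls \<in> set ts)"
    unfolding eligible_def by (auto simp: wsp_of_def simp del: wsp_cons.simps)
  moreover have "authorized (wsp_of N cls) {..<ntasks N} \<pi> \<longleftrightarrow>
      (\<forall>s < 3 * 2 ^ wlen N. \<pi> s = s mod 2 ^ wlen N)"
    using True by (auto simp: authorized_def wsp_of_def ntasks_def split: if_splits)
  ultimately show ?thesis
    using True by (auto simp: valid_complete_plan_def plan_def valid_def wsp_of_def)
qed (auto simp: valid_complete_plan_def plan_def wsp_of_def)

text \<open>The user performing a group task selects a word for the group, and these words form an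
  assignment. If it falsified a clause, the selected slots would clash, and the constraint for this
  clash forbids just that selection.\<close>

lemma plan_imp_satisfiable:
  assumes cnf: "is_3cnf (N, cls)" and \<pi>: "valid_complete_plan (wsp_of N cls) \<pi>"
  shows "satisfiable (N, cls)"
proof -
  define b k n where "b = wlen N" and "k = num_groups N" and "n = (2::nat) ^ b"
  have L: "map \<pi> ls \<in> set ts" if "(ls, ts) \<in> set (cons_lists b k cls)" for ls ts
    using \<pi> that by (auto simp: valid_complete_plan_wsp_of b_def k_def)
  have anchor: "\<pi> s = s mod n" if "s < 3 * n" for s
    using \<pi> that by (auto simp: valid_complete_plan_wsp_of b_def n_def)
  have range: "\<pi> s < n" if "s < 3 * n + 3 * k" for s
    using \<pi> that by (auto simp: valid_complete_plan_wsp_of b_def n_def k_def ntasks_def)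
  have copies: "\<pi> (3 * n + k + j) = \<pi> (3 * n + j)" "\<pi> (3 * n + 2 * k + j) = \<pi> (3 * n + j)" if "j < k" for j
    using L[of "scope3 n k j" "vecs3 n"] that
    by (auto simp: cons_lists_def n_def[symmetric] set_vecs3 scope3_def)
  define \<alpha> where "\<alpha> v = words b ! \<pi> (3 * n + v div b) ! (v mod b)" for v
  have "sat_clause \<alpha> c" if c: "c \<in> set cls" for c
  proof (rule ccontr)
    obtain c\<^sub>1 v\<^sub>1 c\<^sub>2 v\<^sub>2 c\<^sub>3 v\<^sub>3 where c_eq: "c = ((c\<^sub>1, v\<^sub>1), (c\<^sub>2, v\<^sub>2), (c\<^sub>3, v\<^sub>3))"
      by (metis surj_pair)
    assume "\<not> sat_clause \<alpha> c"
    then have neq: "\<alpha> v\<^sub>1 \<noteq> c\<^sub>1" "\<alpha> v\<^sub>2 \<noteq> c\<^sub>2" "\<alpha> v\<^sub>3 \<noteq> c\<^sub>3" by (auto simp: c_eq)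
    let ?p = "\<lambda>v. (v div b, \<pi> (3 * n + v div b))"
    have "v\<^sub>1 < N" "v\<^sub>2 < N" "v\<^sub>3 < N" using cnf c by (auto simp: is_3cnf_def c_eq)
    moreover have "v div b < k" if "v < N" for v
      using that unfolding k_def less_num_groups b_def[symmetric]
      by (metis div_times_less_eq_dividend le_less_trans)
    ultimately have j: "v\<^sub>1 div b < k" "v\<^sub>2 div b < k" "v\<^sub>3 div b < k" by auto
    then have i: "\<pi> (3 * n + v\<^sub>1 div b) < n" "\<pi> (3 * n + v\<^sub>2 div b) < n" "\<pi> (3 * n + v\<^sub>3 div b) < n"
      by (auto intro!: range)
    \<comment> \<open>Each literal is matched with the group of its variable and the user that the
      plan chose there.\<close>
    let ?q = "(?p v\<^sub>1, ?p v\<^sub>2, ?p v\<^sub>3)"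
    have "clash b cls ?q"
      using neq c by (auto simp: falsifies_def c_eq \<alpha>_def intro!: bexI[of _ c])
    moreover have "?q \<in> set (slot_triples n k)"
      using i j by (simp add: set_slot_triples)
    ultimately have "(scope6 n k ?q, vecs6 n) \<in> set (cons_lists b k cls)"
      unfolding cons_lists_def n_def[symmetric] by (auto simp del: clash.simps scope6.simps)
    then have "map \<pi> (scope6 n k ?q) \<in> set (vecs6 n)" by (rule L)
    \<comment> \<open>The anchors in the scope are those of the chosen users, so the anchor values
      repeat the group values, which \<open>vecs6\<close> excludes.\<close>
    moreover have "map \<pi> (scope6 n k ?q) = map \<pi> [3 * n + v\<^sub>1 div b, 3 * n + v\<^sub>2 div b, 3 * n + v\<^sub>3 div b,
        3 * n + v\<^sub>1 div b, 3 * n + v\<^sub>2 div b, 3 * n + v\<^sub>3 div b]"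
      using i by (simp add: copies j anchor mod_if)
    moreover have "map \<pi> [x, y, z, x, y, z] \<notin> set (vecs6 n)" for x y z
      by (simp add: set_vecs6)
    ultimately show False by metis
  qed
  then show ?thesis unfolding satisfiable_def snd_conv by blast
qed

text \<open>Each group task goes to the user whose word is the restriction of a satisfying
  assignment to the group.\<close>

lemma satisfiable_imp_plan:
  assumes sat: "satisfiable (N, cls)"
  shows "\<exists>\<pi>. valid_complete_plan (wsp_of N cls) \<pi>"
proof -
  define b k n where "b = wlen N" and "k = num_groups N" and "n = (2::nat) ^ b"
  have b: "b > 0" using wlen_ge_1[of N] by (simp add: b_def)
  obtain \<alpha> where \<alpha>: "\<And>c. c \<in> set cls \<Longrightarrow> sat_clause \<alpha> c"
    using sat by (auto simp: satisfiable_def)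
  \<comment> \<open>In the last group \<open>j * b + p\<close> may exceed \<open>N\<close>; as
    \<open>\<alpha>\<close> is total, the word exists all the same.\<close>
  have "\<exists>i<n. words b ! i = map (\<lambda>p. \<alpha> (j * b + p)) [0..<b]" for j
  proof -
    have "map (\<lambda>p. \<alpha> (j * b + p)) [0..<b] \<in> set (words b)" by (simp add: set_words)
    then show ?thesis by (auto simp: in_set_conv_nth length_words n_def)
  qed
  then obtain g where g: "\<And>j. g j < n" "\<And>j. words b ! g j = map (\<lambda>p. \<alpha> (j * b + p)) [0..<b]"
    by metis
  \<comment> \<open>\<open>mod k\<close> identifies the three copies of a group task;
    \<open>undefined\<close> outside the tasks makes the plan extensional.\<close>
  define \<pi> where "\<pi> s = (if s < 3 * n then s mod n else if s < 3 * n + 3 * k then g ((s - 3 * n) mod k)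
    else undefined)" for s
  have n: "n > 0" by (simp add: n_def)
  have anchor: "\<pi> s = s mod n" if "s < 3 * n" for s using that by (simp add: \<pi>_def)
  have group: "\<pi> (3 * n + j) = g j" "\<pi> (3 * n + k + j) = g j" "\<pi> (3 * n + 2 * k + j) = g j" if "j < k" for j
    using that by (simp_all add: \<pi>_def)
  have false: "\<not> sat_literal \<alpha> l" if "falsifies b (j, i) l" "g j = i" for j i l
    using that b by (cases l) (auto simp: falsifies_def g(2) mult.commute)
  have "map \<pi> (scope6 n k q) \<in> set (vecs6 n)"
    if q: "q \<in> set (slot_triples n k)" and cl: "clash b cls q" for q
  proof -
    obtain j\<^sub>1 i\<^sub>1 j\<^sub>2 i\<^sub>2 j\<^sub>3 i\<^sub>3 where q_eq: "q = ((j\<^sub>1, i\<^sub>1), (j\<^sub>2, i\<^sub>2), (j\<^sub>3, i\<^sub>3))"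
      and bnd: "j\<^sub>1 < k" "i\<^sub>1 < n" "j\<^sub>2 < k" "i\<^sub>2 < n" "j\<^sub>3 < k" "i\<^sub>3 < n"
      using q by (auto simp: set_slot_triples)
    obtain l\<^sub>1 l\<^sub>2 l\<^sub>3 where c: "(l\<^sub>1, l\<^sub>2, l\<^sub>3) \<in> set cls"
        "falsifies b (j\<^sub>1, i\<^sub>1) l\<^sub>1" "falsifies b (j\<^sub>2, i\<^sub>2) l\<^sub>2" "falsifies b (j\<^sub>3, i\<^sub>3) l\<^sub>3"
      using cl by (auto simp: q_eq)
    have "map \<pi> (scope6 n k q) = [i\<^sub>1, i\<^sub>2, i\<^sub>3, g j\<^sub>1, g j\<^sub>2, g j\<^sub>3]"
      using bnd by (simp add: q_eq group anchor mod_if)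
    moreover have "\<not> (g j\<^sub>1 = i\<^sub>1 \<and> g j\<^sub>2 = i\<^sub>2 \<and> g j\<^sub>3 = i\<^sub>3)"
      using \<alpha>[OF c(1)] false[OF c(2)] false[OF c(3)] false[OF c(4)] by auto
    ultimately show ?thesis using bnd g(1) by (auto simp: set_vecs6 numeral_eq_Suc)
  qed
  moreover have "map \<pi> (scope3 n k j) \<in> set (vecs3 n)" if "j < k" for j
    using group[OF that] g(1)[of j] by (simp add: set_vecs3 scope3_def)
  ultimately have "\<forall>(ls, ts) \<in> set (cons_lists b k cls). map \<pi> ls \<in> set ts"
    unfolding cons_lists_def n_def[symmetric] by auto
  moreover have "\<pi> \<in> {..<3 * n + 3 * k} \<rightarrow>\<^sub>E {..<n}"
    by (rule PiE_I) (use n g(1) in \<open>auto simp: \<pi>_def\<close>)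
  ultimately have "valid_complete_plan (wsp_of N cls) \<pi>"
    unfolding valid_complete_plan_wsp_of b_def[symmetric] k_def[symmetric] ntasks_def n_def[symmetric]
    using anchor by simp
  then show ?thesis by blast
qed

text \<open>A plan is output with a tag and thus differs from \<open>Nl\<close>, so the output for
  WSP can be returned unchanged for 3-SAT.\<close>

lemma wsp_answer_imp_sat3_answer:
  assumes "is_3cnf (N, cls)" "wsp_answer (wsp_of N cls) y"
  shows "sat3_answer (N, cls) y"
proof -
  have "(\<exists>\<pi>. valid_complete_plan (wsp_of N cls) \<pi>) \<longleftrightarrow> satisfiable (N, cls)"
    using plan_imp_satisfiable[OF assms(1)] satisfiable_imp_plan by blast
  with assms(2) show ?thesis
    unfolding wsp_answer_def sat3_answer_def by (cases "satisfiable (N, cls)") auto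
qed

section \<open>Size of the parameters\<close>

lemma length_le_size_enc_list: "length xs \<le> size (enc_list f xs)"
  by (induction xs) auto

text \<open>The output contains the numbers of tasks and users in unary and one list entry per
  constraint.\<close>

lemma wsp_parameters_le_size:
  assumes "p \<in> {num_users, num_tasks, num_constraints, input_length}"
  shows "p (wsp_of N cls, reduction (enc_formula (N, cls))) \<le> size (reduction (enc_formula (N, cls)))"
proof -
  let ?b = "wlen N" and ?k = "num_groups N"
  let ?L = "cons_lists ?b ?k cls"
  have "card (wsp_cons (2 ^ ?b) ` set ?L) \<le> length ?L"
    using card_image_le[of "set ?L" "wsp_cons (2 ^ ?b)"] card_length[of ?L] by simp
  also have "\<dots> \<le> size (enc_list (\<lambda>v. v) (map enc_cons ?L))"
    using length_le_size_enc_list[of "map enc_cons ?L" "\<lambda>v. v"] by simp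
  finally have "card (wsp_cons (2 ^ ?b) ` set ?L) \<le> size (reduction (enc_formula (N, cls)))"
    by (simp add: reduction_enc)
  then show ?thesis
    using assms
    by (auto simp: num_users_def num_tasks_def num_constraints_def input_length_def wsp_of_def
        ntasks_def reduction_enc size_enc_nat)
qed

lemma size_enc_formula:
  assumes "is_3cnf (N, cls)"
  shows "size (enc_formula (N, cls)) \<le> N + 1 + length cls * (3 * N + 10)"
proof -
  have l: "size (enc_literal l) \<le> N + 2" if "snd l < N" for l
    using that by (cases l) (auto simp: enc_bool_def size_enc_nat)
  have "size (enc_clause c) \<le> 3 * N + 9" if "c \<in> set cls" for c
  proof -
    obtain l\<^sub>1 l\<^sub>2 l\<^sub>3 where c: "c = (l\<^sub>1, l\<^sub>2, l\<^sub>3)" by (cases c)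
    then have "snd l\<^sub>1 < N" "snd l\<^sub>2 < N" "snd l\<^sub>3 < N" using assms that by (auto simp: is_3cnf_def)
    from this[THEN l] show ?thesis by (simp add: c del: enc_literal.simps)
  qed
  then have "size (enc_list enc_clause cls) \<le> length cls * Suc (3 * N + 9)"
    by (rule size_enc_list_le)
  also have "Suc (3 * N + 9) = 3 * N + 10" by simp
  finally show ?thesis by (simp add: enc_formula_def size_enc_nat)
qed

text \<open>Let \<open>b = wlen N\<close> and \<open>k = num_groups N\<close>. For
  \<open>N \<ge> 16\<close> also the case \<open>b = 1\<close> has \<open>4 ^ b \<le> N\<close>.
  Then \<open>2 ^ b * b \<le> N\<close> and \<open>k * b \<le> 2 * N\<close>, so
  \<open>ntasks N * b \<le> 9 * N\<close>. From \<open>N < 4 ^ Suc b\<close> the logarithm is at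
  most \<open>8 * b\<close>, and \<open>72 = 9 * 8\<close>.\<close>

lemma ntasks_log_le:
  assumes "N \<ge> 16"
  shows "real (ntasks N) * log 2 (real (ntasks N)) \<le> 72 * real N"
proof -
  let ?b = "wlen N" and ?k = "num_groups N"
  have b: "1 \<le> ?b" and lower: "N < 4 ^ Suc ?b" using wlen_ge_1 wlen_lower by auto
  have 4: "4 ^ ?b \<le> N" using wlen_upper[of N] assms by auto
  have sq: "(2::nat) ^ ?b * 2 ^ ?b = 4 ^ ?b" by (simp flip: power_mult_distrib)
  have "?b \<le> 2 ^ ?b" using less_exp[of ?b] by simp
  then have 2: "2 ^ ?b * ?b \<le> N" using 4 sq mult_le_mono2[of ?b "2 ^ ?b" "2 ^ ?b"] by linarith
  have "?b \<le> N" using 4 less_4_power[of ?b] by linarith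
  moreover have "?k * ?b \<le> N + ?b - 1" unfolding num_groups_def by (rule div_times_less_eq_dividend)
  ultimately have "?k * ?b \<le> 2 * N" by linarith
  with 2 have Kb: "ntasks N * ?b \<le> 9 * N" by (simp add: ntasks_def algebra_simps)
  have "ntasks N \<le> ntasks N * ?b" using b by simp
  then have "ntasks N \<le> 9 * N" using Kb by linarith
  also have "\<dots> \<le> 16 * 4 ^ Suc ?b" using lower by simp
  also have "\<dots> = 2 ^ (2 * ?b + 6)" by (simp add: power_add power_mult)
  also have "\<dots> \<le> 2 ^ (8 * ?b)" using b by (intro power_increasing) auto
  finally have "real (ntasks N) \<le> 2 ^ (8 * ?b)" by (metis of_nat_le_iff of_nat_numeral of_nat_power)
  moreover have pos: "ntasks N > 0" by (simp add: ntasks_def)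
  ultimately have "log 2 (real (ntasks N)) \<le> real (8 * ?b)"
    by (subst log_le_iff) (simp_all add: powr_realpow del: of_nat_mult)
  then have "real (ntasks N) * log 2 (real (ntasks N)) \<le> real (ntasks N) * real (8 * ?b)"
    by (intro mult_left_mono) auto
  also have "\<dots> = 8 * real (ntasks N * ?b)" by simp
  also have "\<dots> \<le> 8 * real (9 * N)" using Kb by (intro mult_left_mono) (simp_all only: of_nat_le_iff)
  finally show ?thesis by simp
qed

text \<open>This permits substituting \<open>ntasks N\<close> for \<open>k\<close> in the little-o
  assumption. The word length grows without bound, and with it the number of anchors.\<close>

lemma filterlim_ntasks: "filterlim ntasks at_top sequentially"
  unfolding filterlim_at_top eventually_sequentially
proof (intro allI exI impI)
  fix Z N :: nat
  assume "4 ^ Z \<le> N"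
  then have "(4::nat) ^ Z < 4 ^ Suc (wlen N)" using wlen_lower le_less_trans by blast
  then have "Z \<le> wlen N" by (simp only: power_strict_increasing_iff)
  also have "wlen N \<le> 2 ^ wlen N" using less_exp[of "wlen N"] by simp
  also have "\<dots> \<le> ntasks N" by (simp add: ntasks_def)
  finally show "Z \<le> ntasks N" .
qed

text \<open>The absolute value keeps the factor \<open>2 powr\<close> at least 1, so that it can
  absorb the cost of the reduction.\<close>

lemma smallo_ntasks:
  assumes "f \<in> o(\<lambda>k::nat. real k * log 2 (real k))"
  shows "(\<lambda>N. \<bar>f (ntasks N)\<bar>) \<in> o(\<lambda>N. real N)"
proof -
  have "(\<lambda>N. f (ntasks N)) \<in> o(\<lambda>N. real (ntasks N) * log 2 (real (ntasks N)))"
    using landau_o.small.compose[OF assms filterlim_ntasks] .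
  moreover have "(\<lambda>N. real (ntasks N) * log 2 (real (ntasks N))) \<in> O(\<lambda>N. real N)"
  proof (rule landau_o.bigI[where c = 72])
    have "0 \<le> real (ntasks N) * log 2 (real (ntasks N))" for N
    proof -
      have "ntasks N \<ge> 1" by (simp add: ntasks_def Suc_le_eq)
      then show ?thesis by simp
    qed
    then show "\<forall>\<^sub>F N in sequentially. norm (real (ntasks N) * log 2 (real (ntasks N))) \<le> 72 * norm (real N)"
      using ntasks_log_le by (intro eventually_sequentiallyI[of 16]) simp
  qed simp
  ultimately have "(\<lambda>N. f (ntasks N)) \<in> o(\<lambda>N. real N)"
    by (rule landau_o.small_big_trans)
  then show ?thesis by simp
qed

section \<open>Running time\<close>

fun expr_bound :: "expr \<Rightarrow> nat" where
  "expr_bound (Var x) = Suc x"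
| "expr_bound NlE = 0"
| "expr_bound (PrE e f) = max (expr_bound e) (expr_bound f)"
| "expr_bound (Hd e) = expr_bound e"
| "expr_bound (Tl e) = expr_bound e"

fun com_bound :: "com \<Rightarrow> nat" where
  "com_bound Skip = 0"
| "com_bound (Assign x e) = max (Suc x) (expr_bound e)"
| "com_bound (Seq c d) = max (com_bound c) (com_bound d)"
| "com_bound (If e c d) = max (expr_bound e) (max (com_bound c) (com_bound d))"
| "com_bound (While e c) = max (expr_bound e) (com_bound c)"

lemma eval_expr_cong:
  "expr_bound e \<le> m \<Longrightarrow> (\<And>i. i < m \<Longrightarrow> s i = r i) \<Longrightarrow> eval_expr e s = eval_expr e r"
  by (induction e) auto

text \<open>The reduction leaves arbitrary contents in high registers; a program mentioning only
  lower ones runs as if these were untouched, in the same time.\<close>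

lemma exec_cong:
  "exec c s t s' \<Longrightarrow> com_bound c \<le> m \<Longrightarrow> (\<And>i. i < m \<Longrightarrow> s i = r i) \<Longrightarrow>
    \<exists>r'. exec c r t r' \<and> (\<forall>i<m. s' i = r' i)"
proof (induction arbitrary: r rule: exec.induct)
  case (Skip s)
  then show ?case using exec.Skip by blast
next
  case (Assign x e s)
  have "eval_expr e s = eval_expr e r"
    using Assign by (intro eval_expr_cong[of _ m]) auto
  then have "\<forall>i<m. (s(x := eval_expr e s)) i = (r(x := eval_expr e r)) i"
    using Assign by simp
  then show ?case using exec.Assign by blast
next
  case (Seq c\<^sub>1 s\<^sub>1 t\<^sub>1 s\<^sub>2 c\<^sub>2 t\<^sub>2 s\<^sub>3)
  have le: "com_bound c\<^sub>1 \<le> m" "com_bound c\<^sub>2 \<le> m" using Seq.prems by auto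
  obtain r\<^sub>2 where 2: "exec c\<^sub>1 r t\<^sub>1 r\<^sub>2" "\<And>i. i < m \<Longrightarrow> s\<^sub>2 i = r\<^sub>2 i"
    using Seq.IH(1)[OF le(1), of r] Seq.prems by blast
  obtain r\<^sub>3 where 3: "exec c\<^sub>2 r\<^sub>2 t\<^sub>2 r\<^sub>3" "\<And>i. i < m \<Longrightarrow> s\<^sub>3 i = r\<^sub>3 i"
    using Seq.IH(2)[OF le(2), of r\<^sub>2] 2 by blast
  show ?case using exec.Seq[OF 2(1) 3(1)] 3(2) by blast
next
  case (IfTrue e s c\<^sub>1 t s' c\<^sub>2)
  have le: "com_bound c\<^sub>1 \<le> m" "expr_bound e \<le> m" using IfTrue.prems by auto
  obtain r' where 2: "exec c\<^sub>1 r t r'" "\<And>i. i < m \<Longrightarrow> s' i = r' i"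
    using IfTrue.IH[OF le(1), of r] IfTrue.prems by blast
  have "eval_expr e r \<noteq> Nl" using IfTrue.hyps IfTrue.prems eval_expr_cong[OF le(2), of s r] by auto
  from exec.IfTrue[OF this 2(1)] 2(2) show ?case by blast
next
  case (IfFalse e s c\<^sub>2 t s' c\<^sub>1)
  have le: "com_bound c\<^sub>2 \<le> m" "expr_bound e \<le> m" using IfFalse.prems by auto
  obtain r' where 2: "exec c\<^sub>2 r t r'" "\<And>i. i < m \<Longrightarrow> s' i = r' i"
    using IfFalse.IH[OF le(1), of r] IfFalse.prems by blast
  have "eval_expr e r = Nl" using IfFalse.hyps IfFalse.prems eval_expr_cong[OF le(2), of s r] by auto
  from exec.IfFalse[OF this 2(1)] 2(2) show ?case by blast
next
  case (WhileFalse e s c)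
  have "eval_expr e r = Nl"
    using WhileFalse eval_expr_cong[of e m s r] by auto
  from exec.WhileFalse[OF this] WhileFalse.prems show ?case by blast
next
  case (WhileTrue e s\<^sub>1 c t\<^sub>1 s\<^sub>2 t\<^sub>2 s\<^sub>3)
  have le: "com_bound c \<le> m" "expr_bound e \<le> m" using WhileTrue.prems by auto
  obtain r\<^sub>2 where 2: "exec c r t\<^sub>1 r\<^sub>2" "\<And>i. i < m \<Longrightarrow> s\<^sub>2 i = r\<^sub>2 i"
    using WhileTrue.IH(1)[OF le(1), of r] WhileTrue.prems by blast
  obtain r\<^sub>3 where 3: "exec (While e c) r\<^sub>2 t\<^sub>2 r\<^sub>3" "\<And>i. i < m \<Longrightarrow> s\<^sub>3 i = r\<^sub>3 i"
    using WhileTrue.IH(2)[OF WhileTrue.prems(1), of r\<^sub>2] 2 by blast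
  have "eval_expr e r \<noteq> Nl" using WhileTrue.hyps WhileTrue.prems eval_expr_cong[OF le(2), of s\<^sub>1 r] by auto
  from exec.WhileTrue[OF this 2(1) 3(1)] 3(2) show ?case by blast
qed

text \<open>\<open>f\<close> is computed in registers above all those of \<open>P\<close>, which
  therefore still finds \<open>Nl\<close> in its variables other than 0.\<close>

lemma runs_ptime_comp:
  assumes "ptime f"
  obtains p Q where "npoly p"
    "\<And>x t y. runs P (f x) t y \<Longrightarrow> \<exists>t'. runs Q x t' y \<and> t' \<le> p (size x) + t"
proof -
  obtain p R where p: "npoly p" "\<And>x. size (f x) \<le> p (size x)" "\<And>m. computes_at m f p (R m)"
    using assms by (rule ptimeE) blast
  \<comment> \<open>\<open>Suc\<close> keeps \<open>m\<close> apart from the input and output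
    register 0 even if \<open>P\<close> mentions no register.\<close>
  define m where "m = Suc (com_bound P)"
  let ?Q = "Seq (Assign m (Var 0)) (Seq (R m) (Seq (Assign 0 (Var m)) P))"
  show thesis
  proof (rule that[where p = "\<lambda>n. 4 + p n" and Q = ?Q])
    show "npoly (\<lambda>n. 4 + p n)" by (intro npoly_intros p)
    fix x t y
    assume "runs P (f x) t y"
    then obtain s where s: "exec P ((\<lambda>_. Nl)(0 := f x)) t s" "s 0 = y"
      by (auto simp: runs_def)
    let ?s0 = "(\<lambda>_. Nl)(0 := x)"
    let ?s1 = "?s0(m := x)"
    obtain u s2 where 2: "exec (R m) ?s1 u s2" "s2 m = f x" "\<And>i. i < m \<Longrightarrow> s2 i = ?s0 i"
        "u \<le> p (size x)"
      using p(3)[of m] by (rule computes_atE[where s = ?s1]) auto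
    let ?s3 = "s2(0 := f x)"
    have "((\<lambda>_. Nl)(0 := f x)) i = ?s3 i" if "i < m" for i
      using 2(3)[OF that] by simp
    moreover have "com_bound P \<le> m" by (simp add: m_def)
    ultimately obtain r where r: "exec P ?s3 t r" "\<And>i. i < m \<Longrightarrow> s i = r i"
      using exec_cong[OF s(1), of m ?s3] by blast
    have "exec ?Q ?s0 (2 + (u + (2 + t))) r"
      using 2 r(1) by (intro exec.Seq[OF _ exec.Seq[OF _ exec.Seq]] exec_Assign) (auto simp: m_def)
    moreover have "r 0 = y" using r(2)[of 0] s(2) by (simp add: m_def)
    ultimately show "\<exists>t'. runs ?Q x t' y \<and> t' \<le> 4 + p (size x) + t"
      unfolding runs_def using 2(4) by (intro exI[of _ "2 + (u + (2 + t))"]) auto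
  qed
qed

text \<open>Rounding absolute values of coefficients up and replacing all parameters by a common
  bound \<open>R\<close> gives a monotone polynomial in one variable.\<close>

lemma polynomial_in_bound:
  assumes "polynomial_in X q"
  shows "\<exists>p. npoly p \<and> (\<forall>i R. (\<forall>f \<in> X. f i \<le> R) \<longrightarrow> \<bar>q i\<bar> \<le> real (p R))"
  using assms
proof induction
  case (const c)
  have "\<bar>c\<bar> \<le> real (nat \<lceil>\<bar>c\<bar>\<rceil>)" by linarith
  then show ?case using npoly_const by blast
next
  case (param p)
  then show ?case using npoly_id by fastforce
next
  case (add q r)
  then obtain p p' where "npoly p" "npoly p'"
      "\<And>i R. \<forall>f \<in> X. f i \<le> R \<Longrightarrow> \<bar>q i\<bar> \<le> real (p R)" "\<And>i R. \<forall>f \<in> X. f i \<le> R \<Longrightarrow> \<bar>r i\<bar> \<le> real (p' R)"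
    by blast
  then show ?case
    by (intro exI[of _ "\<lambda>n. p n + p' n"])
      (auto intro!: npoly_intros order_trans[OF abs_triangle_ineq] add_mono)
next
  case (mult q r)
  then obtain p p' where "npoly p" "npoly p'"
      "\<And>i R. \<forall>f \<in> X. f i \<le> R \<Longrightarrow> \<bar>q i\<bar> \<le> real (p R)" "\<And>i R. \<forall>f \<in> X. f i \<le> R \<Longrightarrow> \<bar>r i\<bar> \<le> real (p' R)"
    by blast
  then show ?case
    by (intro exI[of _ "\<lambda>n. p n * p' n"]) (auto intro!: npoly_intros mult_mono simp: abs_mult)
qed

lemma polynomial_in_npoly:
  assumes "npoly p" "polynomial_in X (\<lambda>i. real (r i))"
  shows "polynomial_in X (\<lambda>i. real (p (r i)))"
  using assms(1)
proof induction
  case (npoly_const c)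
  show ?case by (rule polynomial_in.const)
qed (use assms(2) in \<open>auto intro: polynomial_in.add polynomial_in.mult\<close>)

lemma polynomial_in_mono: "polynomial_in X q \<Longrightarrow> X \<subseteq> Y \<Longrightarrow> polynomial_in Y q"
  by (induction rule: polynomial_in.induct) (auto intro: polynomial_in.intros)

section \<open>Transfer of time bounds from WSP to 3-SAT\<close>

lemma solvable_in_Ostar_mono:
  "solvable_in_Ostar D ans X h \<Longrightarrow> X \<subseteq> Y \<Longrightarrow> solvable_in_Ostar D ans Y h"
  unfolding solvable_in_Ostar_def using polynomial_in_mono by blast

text \<open>The reduction is followed by the solver for WSP. The parameters of the target are
  bounded by its size, hence polynomially in the size of the formula, and its number of tasks
  depends on \<open>N\<close> only.\<close>

lemma sat3_solvable_if_ui_wsp_solvable: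
  assumes "solvable_in_Ostar ui_wsp_inputs wsp_answer
      {num_users, num_tasks, num_constraints, input_length} (\<lambda>i. 2 powr f (num_tasks i))"
  shows "solvable_in_Ostar sat3_inputs sat3_answer {num_vars, num_clauses}
      (\<lambda>i. 2 powr \<bar>f (ntasks (num_vars i))\<bar>)"
proof -
  let ?X = "{num_users, num_tasks, num_constraints, input_length}"
  obtain P q C where q: "polynomial_in ?X q" and P: "\<And>W x. (W, x) \<in> ui_wsp_inputs \<Longrightarrow>
      \<exists>t y. runs P x t y \<and> wsp_answer W y \<and> real t \<le> C * (q (W, x) * 2 powr f (num_tasks (W, x)))"
    using assms unfolding solvable_in_Ostar_def by blast
  obtain p where p: "npoly p" "\<And>i R. \<forall>g \<in> ?X. g i \<le> R \<Longrightarrow> \<bar>q i\<bar> \<le> real (p R)"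
    using polynomial_in_bound[OF q] by blast
  obtain p' Q where Q: "npoly p'"
      "\<And>x t y. runs P (reduction x) t y \<Longrightarrow> \<exists>t'. runs Q x t' y \<and> t' \<le> p' (size x) + t"
    using runs_ptime_comp[OF ptime_reduction] by blast
  obtain r where r: "npoly r" "\<And>x. size (reduction x) \<le> r (size x)"
    using ptime_reduction by (rule ptimeE) blast
  define c where "c = nat \<lceil>\<bar>C\<bar>\<rceil>"
  \<comment> \<open>\<open>T n\<close> is the polynomial factor in the time for formulas of size
    \<open>n\<close>; \<open>S\<close> bounds this size in the parameters of 3-SAT.\<close>
  define T where "T n = p' n + c * p (r n)" for n
  have T: "npoly T" unfolding T_def by (intro npoly_intros npoly_comp[OF p(1)] Q(1) r(1))
  define S where "S i = num_vars i + 1 + num_clauses i * (3 * num_vars i + 10)" for i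
  have S: "polynomial_in {num_vars, num_clauses} (\<lambda>i. real (S i))"
    unfolding S_def of_nat_add of_nat_mult by (intro polynomial_in.intros) auto
  show ?thesis
    unfolding solvable_in_Ostar_def
  proof (intro exI conjI)
    show "polynomial_in {num_vars, num_clauses} (\<lambda>i. real (T (S i)))"
      by (rule polynomial_in_npoly[OF T S])
    show "\<forall>(\<phi>, x) \<in> sat3_inputs. \<exists>t y. runs Q x t y \<and> sat3_answer \<phi> y \<and>
        real t \<le> 1 * (real (T (S (\<phi>, x))) * 2 powr \<bar>f (ntasks (num_vars (\<phi>, x)))\<bar>)"
    proof clarify
      fix N cls x
      assume "((N, cls), x) \<in> sat3_inputs"
      then have cnf: "is_3cnf (N, cls)" and x: "x = enc_formula (N, cls)"
        by (auto simp: sat3_inputs_def)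
      let ?i = "(wsp_of N cls, reduction x)" and ?h = "2 powr \<bar>f (ntasks N)\<bar>"
      obtain t y where run: "runs P (reduction x) t y" and ans: "wsp_answer (wsp_of N cls) y"
          and t: "real t \<le> C * (q ?i * 2 powr f (num_tasks ?i))"
        using P[OF reduction_wsp_of[of N cls]] unfolding x by blast
      obtain t' where t': "runs Q x t' y" "t' \<le> p' (size x) + t"
        using Q(2)[OF run] by blast
      have K: "num_tasks ?i = ntasks N" by (simp add: num_tasks_def wsp_of_def)
      have "\<bar>q ?i\<bar> \<le> real (p (size (reduction x)))"
        by (rule p(2)) (use wsp_parameters_le_size[of _ N cls] x in blast)
      also have "\<dots> \<le> real (p (r (size x)))"
        using npoly_mono[OF p(1) r(2)] by simp
      finally have q_le: "\<bar>q ?i\<bar> \<le> real (p (r (size x)))" .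
      \<comment> \<open>\<open>C\<close> and \<open>q\<close> may take negative values, so absolute
        values come before the monotone estimates.\<close>
      have "C * (q ?i * 2 powr f (num_tasks ?i)) \<le> \<bar>C\<bar> * (\<bar>q ?i\<bar> * 2 powr f (num_tasks ?i))"
        using abs_ge_self[of "C * (q ?i * 2 powr f (num_tasks ?i))"] by (simp add: abs_mult)
      also have "\<dots> \<le> real c * (real (p (r (size x))) * ?h)"
        unfolding K by (intro mult_mono q_le powr_mono) (auto simp: c_def)
      finally have "real t \<le> real (c * p (r (size x))) * ?h" using t by simp
      \<comment> \<open>The time of the reduction is absorbed because the exponential factor is at
        least 1.\<close>
      moreover have "real (p' (size x)) * 1 \<le> real (p' (size x)) * ?h"
        by (intro mult_left_mono ge_one_powr_ge_zero) auto
      ultimately have "real t' \<le> real (T (size x)) * ?h"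
        using t'(2) by (simp add: T_def algebra_simps)
      also have "\<dots> \<le> real (T (S ((N, cls), x))) * ?h"
      proof (intro mult_right_mono)
        have "size x \<le> S ((N, cls), x)"
          using size_enc_formula[OF cnf] by (simp add: x S_def num_vars_def num_clauses_def)
        then show "real (T (size x)) \<le> real (T (S ((N, cls), x)))"
          using npoly_mono[OF T] by simp
      qed simp
      finally have "real t' \<le> 1 * (real (T (S ((N, cls), x))) * ?h)" by simp
      with t'(1) wsp_answer_imp_sat3_answer[OF cnf ans]
      show "\<exists>t y. runs Q x t y \<and> sat3_answer (N, cls) y \<and>
          real t \<le> 1 * (real (T (S ((N, cls), x))) * 2 powr \<bar>f (ntasks (num_vars ((N, cls), x)))\<bar>)"
        unfolding num_vars_def fst_conv by blast
    qed
  qed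
qed

theorem theorem18:
  assumes "ETH"
  shows "\<not> (\<exists>f \<in> o(\<lambda>k::nat. real k * log 2 (real k)).
            solvable_in_Ostar ui_wsp_inputs wsp_answer
              {num_users, num_tasks, num_constraints}
              (\<lambda>i. 2 powr f (num_tasks i)))
       \<and> \<not> (\<exists>f \<in> o(\<lambda>k::nat. real k * log 2 (real k)).
            solvable_in_Ostar ui_wsp_inputs wsp_answer
              {num_users, num_tasks, num_constraints, input_length}
              (\<lambda>i. 2 powr f (num_tasks i)))"
proof -
  have "\<not> solvable_in_Ostar ui_wsp_inputs wsp_answer
      {num_users, num_tasks, num_constraints, input_length} (\<lambda>i. 2 powr f (num_tasks i))"
    if f: "f \<in> o(\<lambda>k::nat. real k * log 2 (real k))" for f
  proof
    assume "solvable_in_Ostar ui_wsp_inputs wsp_answer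
      {num_users, num_tasks, num_constraints, input_length} (\<lambda>i. 2 powr f (num_tasks i))"
    from sat3_solvable_if_ui_wsp_solvable[OF this]
    have "\<exists>g \<in> o(\<lambda>N::nat. real N). solvable_in_Ostar sat3_inputs sat3_answer {num_vars, num_clauses}
        (\<lambda>i. 2 powr g (num_vars i))"
      by (rule bexI[where x = "\<lambda>N. \<bar>f (ntasks N)\<bar>"]) (rule smallo_ntasks[OF f])
    with assms show False unfolding ETH_def by contradiction
  qed
  \<comment> \<open>A polynomial in fewer parameters is one in more, so the bound that admits
    \<open>input_length\<close> implies the other.\<close>
  moreover have "{num_users, num_tasks, num_constraints} \<subseteq>
      {num_users, num_tasks, num_constraints, input_length}" by blast
  ultimately show ?thesis using solvable_in_Ostar_mono by blast
qed

end
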